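(* There is an absolute numerical constant $C>0$ such that for every stochastic $K$-armed bandit ($K\ge2$) with reward distributions supported on $[0,1]$ and means $\mu_1\ge\cdots\ge\mu_K$, and every horizon $T\ge1$, the KL-MS algorithm satisfies \[ \mathrm{Reg}(T)\le C\Big(\sqrt{\dot\mu_1 KT\ln K}+K\ln T\Big),\qquad \dot\mu_1=\mu_1(1-\mu_1). \]
   Context: Bandit model: arm $i\in[K]$ has reward distribution $\nu_i$ on $[0,1]$ with mean $\mu_i$, indexed so $\mu_1\ge\cdots\ge\mu_K$. At round $t$ the learner picks $I_t$ and observes $y_t\sim\nu_{I_t}$ independently of the past given $I_t$. $N_{t,a}$ = number of pulls of arm $a$ in rounds $1..t$; $\hat\mu_{t,a}$ = empirical mean of arm $a$'s rewards up to round $t$; $\hat\mu_{t,\max}=\max_a\hat\mu_{t,a}$; $\mathrm{Reg}(T)=T\mu_1-\mathbb E\sum_{t=1}^Ty_t$. $\mathsf{kl}(p,q)=p\ln\frac pq+(1-p)\ln\frac{1-p}{1-q}$. KL-MS: for $t\le K$ pull arm $t$; for $t\ge K+1$ pull $I_t\sim p_t$ with $p_{t,a}\propto\exp(-N_{t-1,a}\,\mathsf{kl}(\hat\mu_{t-1,a},\hat\mu_{t-1,\max}))$. *)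

theory Defs
  imports "HOL-Probability.Probability"
begin

definition xlx :: "real \<Rightarrow> real \<Rightarrow> ereal" where
  "xlx x y = (if x = 0 then 0 else if y = 0 then \<infinity> else ereal (x * ln (x / y)))"

definition kl :: "real \<Rightarrow> real \<Rightarrow> ereal" where
  "kl p q = xlx p q + xlx (1 - p) (1 - q)"

text \<open>State after t rounds: pull counts N and reward sums S per arm.\<close>

definition klms_weight :: "nat \<Rightarrow> (nat \<Rightarrow> nat) \<Rightarrow> (nat \<Rightarrow> real) \<Rightarrow> nat \<Rightarrow> real" where
  "klms_weight K N S a =
     (let mh = (\<lambda>b. S b / real (N b));
          mmax = Max (mh ` {1..K});
          d = kl (mh a) mmax
      in if d = \<infinity> then 0 else exp (- real (N a) * real_of_ereal d))"

text \<open>Sampling an arm from p_a = w a / (sum w) by inversion with u uniform on [0,1].\<close>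

definition klms_sample :: "nat \<Rightarrow> (nat \<Rightarrow> real) \<Rightarrow> real \<Rightarrow> nat" where
  "klms_sample K w u =
     (if \<exists>a\<in>{1..K}. u < (\<Sum>b=1..a. w b) / (\<Sum>b=1..K. w b)
      then (LEAST a. a \<in> {1..K} \<and> u < (\<Sum>b=1..a. w b) / (\<Sum>b=1..K. w b))
      else K)"

definition klms_choice :: "nat \<Rightarrow> (nat \<Rightarrow> nat) \<Rightarrow> (nat \<Rightarrow> real) \<Rightarrow> real \<Rightarrow> nat \<Rightarrow> nat" where
  "klms_choice K N S u t = (if t \<le> K then t else klms_sample K (klms_weight K N S) u)"

text \<open>Outcome \<omega>: \<omega> (Inl (a,n)) is the reward of the (n+1)-th pull of arm a,
  \<omega> (Inr t) is the auxiliary uniform variable used at round t.\<close>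

fun klms_state :: "nat \<Rightarrow> ((nat \<times> nat) + nat \<Rightarrow> real) \<Rightarrow> nat \<Rightarrow> (nat \<Rightarrow> nat) \<times> (nat \<Rightarrow> real)" where
  "klms_state K \<omega> 0 = (\<lambda>_. 0, \<lambda>_. 0)"
| "klms_state K \<omega> (Suc t) =
     (let (N, S) = klms_state K \<omega> t;
          a = klms_choice K N S (\<omega> (Inr (Suc t))) (Suc t);
          y = \<omega> (Inl (a, N a))
      in (N(a := Suc (N a)), S(a := S a + y)))"

definition klms_arm :: "nat \<Rightarrow> ((nat \<times> nat) + nat \<Rightarrow> real) \<Rightarrow> nat \<Rightarrow> nat" where
  "klms_arm K \<omega> t = (let (N, S) = klms_state K \<omega> (t - 1) in klms_choice K N S (\<omega> (Inr t)) t)"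

definition klms_reward :: "nat \<Rightarrow> ((nat \<times> nat) + nat \<Rightarrow> real) \<Rightarrow> nat \<Rightarrow> real" where
  "klms_reward K \<omega> t = (let (N, S) = klms_state K \<omega> (t - 1); a = klms_arm K \<omega> t in \<omega> (Inl (a, N a)))"

definition bandit_space :: "nat \<Rightarrow> (nat \<Rightarrow> real measure) \<Rightarrow> ((nat \<times> nat) + nat \<Rightarrow> real) measure" where
  "bandit_space K nu = PiM UNIV
     (case_sum (\<lambda>(a, n). if a \<in> {1..K} then nu a else return borel 0)
               (\<lambda>t. uniform_measure lborel {0..1}))"

definition arm_mean :: "(nat \<Rightarrow> real measure) \<Rightarrow> nat \<Rightarrow> real" where
  "arm_mean nu a = (\<integral>x. x \<partial>(nu a))"

definition klms_regret :: "nat \<Rightarrow> (nat \<Rightarrow> real measure) \<Rightarrow> nat \<Rightarrow> real" where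
  "klms_regret K nu T = real T * arm_mean nu 1
      - (\<integral>\<omega>. (\<Sum>t=1..T. klms_reward K \<omega> t) \<partial>(bandit_space K nu))"

end

theory Submission
  imports Defs
begin

text \<open>The regret is \<open>\<Sum>\<^sub>a \<Delta>\<^sub>a E N\<^sub>T\<^sub>,\<^sub>a\<close>. For a suboptimal arm put \<open>v = \<mu>\<^sub>1 (1 - \<mu>\<^sub>1)\<close>,
  \<open>\<theta> = \<mu>\<^sub>a + \<Delta>\<^sub>a/4\<close>, \<open>c = \<mu>\<^sub>1 - \<Delta>\<^sub>a/4\<close> and \<open>\<kappa> = \<Delta>\<^sub>a\<^sup>2 / (32 (v + \<Delta>\<^sub>a))\<close>; then \<open>\<kappa>\<close> is below each of
  \<open>kl \<theta> \<mu>\<^sub>a\<close>, \<open>kl \<theta> c\<close> and \<open>kl c \<mu>\<^sub>1\<close>, and \<open>E N\<^sub>T\<^sub>,\<^sub>a \<lesssim> ln (T\<kappa>) / \<kappa>\<close>. Indeed a pull of \<open>a\<close> falls into one of four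
  classes: the first \<open>ln (T\<kappa>) / \<kappa>\<close> pulls; pulls with empirical mean of \<open>a\<close> at least \<open>\<theta>\<close> (Chernoff); pulls at
  which \<open>a\<close> looks bad and the best empirical mean is at least \<open>c\<close> (probability at most \<open>1/(T\<kappa>)\<close> by the sampling
  rule); pulls at which all empirical means are below \<open>c\<close>. In the last class the sampling rule gives
  \<open>p\<^sub>a \<le> p\<^sub>1 exp (N\<^sub>1 kl \<mu>'\<^sub>1 c)\<close>, with \<open>\<mu>'\<^sub>1\<close> the empirical mean of arm 1, so pulls of \<open>a\<close> are charged to
  pulls of arm 1, and one sums over the number \<open>s\<close> of the latter. The factor is kept below \<open>(2T/s)\<^sup>4\<close> by discarding the event
  that \<open>kl \<mu>'\<^sub>1 c\<close> ever exceeds \<open>4 ln (2T/s) / s\<close>; a maximal inequality on dyadic blocks shows that this event has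
  probability of order \<open>1/(T\<kappa>)\<^sup>2\<close>. Arms with \<open>\<Delta>\<^sub>a \<le> sqrt (v K ln K / T)\<close> contribute at most \<open>sqrt (v K T ln K)\<close> in total.\<close>

section \<open>Binary relative entropy\<close>

definition klr :: "real \<Rightarrow> real \<Rightarrow> real" where
  "klr p q = p * ln (p / q) + (1 - p) * ln ((1 - p) / (1 - q))"

text \<open>With \<open>x / 0 = 0\<close> and \<open>ln 0 = 0\<close>, the real-valued
  \<open>klr\<close> has the right value wherever the divergence is finite. It is infinite exactly
  when the second argument is 0 or 1 and the first differs from it.\<close>

lemma kl_eq:
  "kl p q = (if (p = 0 \<or> q \<noteq> 0) \<and> (p = 1 \<or> q \<noteq> 1) then ereal (klr p q) else \<infinity>)"
  by (auto simp: kl_def xlx_def klr_def)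

lemma klr_self [simp]: "klr p p = 0"
  by (simp add: klr_def)

lemma klr_flip: "klr (1 - p) (1 - q) = klr p q"
  by (simp add: klr_def)

text \<open>This is \<open>ln z \<le> z - 1\<close> at \<open>z = q / p\<close>. Added up for
  \<open>(p, q)\<close> and \<open>(1 - p, 1 - q)\<close> the left sides cancel, which is Gibbs'
  inequality.\<close>

lemma mult_ln_divide_ge:
  fixes p q :: real
  assumes "0 \<le> p" "0 < q"
  shows "p - q \<le> p * ln (p / q)"
proof (cases "p = 0")
  case True
  then show ?thesis using assms by simp
next
  case False
  then have p: "0 < p" using assms by simp
  have "ln (q / p) \<le> q / p - 1" using p assms by (intro ln_le_minus_one) simp
  then have "p * ln (q / p) \<le> p * (q / p - 1)" using p by (intro mult_left_mono) auto
  also have "\<dots> = q - p" using p by (simp add: field_simps)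
  finally show ?thesis using p assms by (simp add: ln_div algebra_simps)
qed

lemma klr_nonneg:
  assumes "0 \<le> p" "p \<le> 1" "0 < q" "q < 1"
  shows "0 \<le> klr p q"
  using mult_ln_divide_ge[of p q] mult_ln_divide_ge[of "1 - p" "1 - q"] assms
  by (simp add: klr_def)

text \<open>A one-sided Pythagorean inequality: the defect is \<open>c - x\<close> times the
  difference of the log-odds of \<open>b\<close> and \<open>c\<close>, and both factors are
  nonnegative. It splits off the fixed cost \<open>klr c b\<close> from the deviation of
  \<open>x\<close> below \<open>c\<close>.\<close>

lemma klr_superadditive:
  assumes "0 \<le> x" "x \<le> c" "0 < c" "c \<le> b" "b < 1"
  shows "klr x c + klr c b \<le> klr x b"
proof -
  have split: "z * ln (z / b') = z * ln (z / c') + z * ln (c' / b')"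
    if "0 \<le> z" "0 < c'" "0 < b'" for z b' c' :: real
    using that by (cases "z = 0") (auto simp: ln_div algebra_simps)
  have "klr x b = klr x c + x * ln (c / b) + (1 - x) * ln ((1 - c) / (1 - b))"
    using split[of x c b] split[of "1 - x" "1 - c" "1 - b"] assms by (simp add: klr_def)
  then have "klr x b - klr x c - klr c b = (c - x) * (ln ((1 - c) / (1 - b)) - ln (c / b))"
    by (simp add: klr_def algebra_simps)
  moreover have "0 \<le> ln ((1 - c) / (1 - b))" "ln (c / b) \<le> 0"
    using assms by (auto simp: ln_le_zero_iff)
  ultimately have "0 \<le> klr x b - klr x c - klr c b"
    using assms by (metis diff_ge_0_iff_ge mult_nonneg_nonneg order_trans)
  then show ?thesis by simp
qed

text \<open>Shrinking the interval between the two arguments at either end drops a nonnegative term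
  from superadditivity.\<close>

lemma klr_mono:
  assumes "0 \<le> p" "p \<le> p'" "0 < p'" "p' \<le> q'" "q' \<le> q" "q < 1"
  shows "klr p' q' \<le> klr p q"
proof -
  have "klr p p' + klr p' q' \<le> klr p q'" "klr p q' + klr q' q \<le> klr p q"
    using assms by (auto intro!: klr_superadditive)
  moreover have "0 \<le> klr p p'" "0 \<le> klr q' q" using assms by (auto intro!: klr_nonneg)
  ultimately show ?thesis by linarith
qed

text \<open>The derivative in the second argument \<open>x\<close> is
  \<open>(x - p) / (x * (1 - x))\<close>, at least \<open>(x - p) / V\<close>. This refines
  Pinsker's inequality by a variance bound on the interval, and so brings
  \<open>\<mu> 1 * (1 - \<mu> 1)\<close> into the rate.\<close>

lemma klr_quadratic_lower:
  assumes "0 < p" "p \<le> q" "q < 1" and V: "\<And>x. p \<le> x \<Longrightarrow> x \<le> q \<Longrightarrow> x * (1 - x) \<le> V"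
  shows "(q - p)\<^sup>2 / (2 * V) \<le> klr p q"
proof -
  have "0 < p * (1 - p)" using assms by simp
  also have "\<dots> \<le> V" using V[of p] assms by simp
  finally have Vpos: "0 < V" .
  let ?h = "\<lambda>z. p * ln (p / z) + (1 - p) * ln ((1 - p) / (1 - z)) - (z - p)\<^sup>2 / (2 * V)"
  have "?h p \<le> ?h q"
  proof (rule DERIV_nonneg_imp_nondecreasing[OF \<open>p \<le> q\<close>])
    fix x assume x: "p \<le> x" "x \<le> q"
    then have x01: "0 < x" "x < 1" using assms by auto
    let ?d = "(1 - p) / (1 - x) - p / x - (x - p) / V"
    have "?d = (x - p) * (1 / (x * (1 - x)) - 1 / V)"
    proof -
      have "(1 - p) / (1 - x) - p / x = (x - p) / (x * (1 - x))"
      proof -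
        have "(1 - p) / (1 - x) - p / x = ((1 - p) * x - p * (1 - x)) / ((1 - x) * x)"
          using x01 by (intro diff_frac_eq) auto
        also have "(1 - p) * x - p * (1 - x) = x - p" by algebra
        finally show ?thesis by (simp only: mult.commute)
      qed
      then show ?thesis by (simp only: right_diff_distrib) simp
    qed
    moreover have "0 \<le> (x - p) * (1 / (x * (1 - x)) - 1 / V)"
      using x x01 V[OF x] Vpos by (intro mult_nonneg_nonneg) (auto intro!: frac_le)
    moreover have "(?h has_real_derivative ?d) (at x)"
    proof -
      have "((\<lambda>z. p * ln (p / z)) has_real_derivative - p / x) (at x)"
        using x01 assms(1) by (auto intro!: derivative_eq_intros)
      moreover have "((\<lambda>z. (1 - p) * ln ((1 - p) / (1 - z))) has_real_derivative (1 - p) / (1 - x)) (at x)"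
        using x01 x assms(2,3) by (auto intro!: derivative_eq_intros)
      moreover have "((\<lambda>z. (z - p)\<^sup>2 / (2 * V)) has_real_derivative (x - p) / V) (at x)"
        using Vpos by (auto intro!: derivative_eq_intros simp: field_simps)
      ultimately have "(?h has_real_derivative - p / x + (1 - p) / (1 - x) - (x - p) / V) (at x)"
        by (intro DERIV_add DERIV_diff)
      then show ?thesis by simp
    qed
    ultimately show "\<exists>y. (?h has_real_derivative y) (at x) \<and> 0 \<le> y" by (intro exI[of _ ?d]) simp
  qed
  then show ?thesis using assms by (simp add: klr_def)
qed

lemma continuous_on_mult_ln: "continuous_on {0..} (\<lambda>x::real. x * ln x)"
  unfolding continuous_on_eq_continuous_within
proof
  fix x :: real assume "x \<in> {0..}"
  show "continuous (at x within {0..}) (\<lambda>x. x * ln x)"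
  proof (cases "x = 0")
    case True
    \<comment> \<open>A lower bound vanishing at 0 for the sandwich, from
      \<open>ln z \<le> z - 1\<close> applied to \<open>1 / sqrt z\<close>.\<close>
    have low: "- 2 * sqrt z \<le> z * ln z" if "0 < z" for z :: real
    proof -
      have "- ln (sqrt z) \<le> 1 / sqrt z - 1"
        using that ln_le_minus_one[of "1 / sqrt z"] by (simp add: ln_div)
      then have "- ln z \<le> 2 / sqrt z" using that by (simp add: ln_sqrt)
      then have "z * (- ln z) \<le> z * (2 / sqrt z)" using that by (intro mult_left_mono) auto
      also have "\<dots> = 2 * (z / sqrt z)" by simp
      also have "z / sqrt z = sqrt z" using that by (simp add: real_div_sqrt)
      finally show ?thesis by simp
    qed
    have "((\<lambda>z::real. z * ln z) \<longlongrightarrow> 0) (at_right 0)"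
    proof (rule tendsto_sandwich)
      show "\<forall>\<^sub>F z in at_right (0::real). - 2 * sqrt z \<le> z * ln z"
        using low by (auto simp: eventually_at_filter)
      show "\<forall>\<^sub>F z in at_right (0::real). z * ln z \<le> 0"
        unfolding eventually_at_right_field
        by (intro exI[of _ 1]) (auto simp: mult_nonneg_nonpos)
      have "((\<lambda>z. - 2 * sqrt z) \<longlongrightarrow> - 2 * sqrt 0) (at_right (0::real))"
        by (intro tendsto_intros)
      then show "((\<lambda>z. - 2 * sqrt z) \<longlongrightarrow> 0) (at_right (0::real))" by simp
    qed simp
    moreover have "at (0::real) within {0..} = at_right 0"
      by (metis at_within_Icc_at_right at_within_Ici_at_right)
    ultimately show ?thesis using True by (simp add: continuous_within)
  next
    case False
    then show ?thesis using \<open>x \<in> {0..}\<close> by (intro continuous_intros) auto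
  qed
qed

text \<open>Continuity down to 0 lets the intermediate value theorem reach every level between 0 and
  \<open>klr 0 c\<close>.\<close>

lemma continuous_on_klr:
  assumes "0 < c" "c < 1"
  shows "continuous_on {0..c} (\<lambda>x. klr x c)"
proof -
  have eq: "klr x c = x * ln x + ((1 - x) * ln (1 - x) - x * ln c - (1 - x) * ln (1 - c))"
    if "x \<in> {0..c}" for x
    using that assms by (cases "x = 0") (auto simp: klr_def ln_div algebra_simps)
  have "continuous_on {0..c} (\<lambda>x::real. x * ln x)"
    by (rule continuous_on_subset[OF continuous_on_mult_ln]) auto
  moreover have "continuous_on {0..c} (\<lambda>x. (1 - x) * ln (1 - x) - x * ln c - (1 - x) * ln (1 - c))"
    using assms by (intro continuous_intros) auto
  ultimately have "continuous_on {0..c}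
      (\<lambda>x. x * ln x + ((1 - x) * ln (1 - x) - x * ln c - (1 - x) * ln (1 - c)))"
    by (rule continuous_on_add)
  then show ?thesis by (rule continuous_on_eq) (simp only: eq)
qed

section \<open>Sample paths\<close>

abbreviation pulls :: "nat \<Rightarrow> (nat \<times> nat + nat \<Rightarrow> real) \<Rightarrow> nat \<Rightarrow> nat \<Rightarrow> nat" where
  "pulls K \<omega> t \<equiv> fst (klms_state K \<omega> t)"

abbreviation totals :: "nat \<Rightarrow> (nat \<times> nat + nat \<Rightarrow> real) \<Rightarrow> nat \<Rightarrow> nat \<Rightarrow> real" where
  "totals K \<omega> t \<equiv> snd (klms_state K \<omega> t)"

text \<open>Indexed by pulls of one arm and not by rounds: for fixed \<open>n\<close> it is a sum of
  independent rewards, however the learner behaves.\<close>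

definition part_sum :: "(nat \<times> nat + nat \<Rightarrow> real) \<Rightarrow> nat \<Rightarrow> nat \<Rightarrow> real" where
  "part_sum \<omega> a n = (\<Sum>i<n. \<omega> (Inl (a, i)))"

lemma klms_arm_Suc:
  "klms_arm K \<omega> (Suc t) = klms_choice K (pulls K \<omega> t) (totals K \<omega> t) (\<omega> (Inr (Suc t))) (Suc t)"
  by (simp add: klms_arm_def case_prod_beta)

lemma klms_state_Suc:
  "klms_state K \<omega> (Suc t) =
     (let a = klms_arm K \<omega> (Suc t) in
      ((pulls K \<omega> t)(a := Suc (pulls K \<omega> t a)),
       (totals K \<omega> t)(a := totals K \<omega> t a + \<omega> (Inl (a, pulls K \<omega> t a)))))"
  by (simp add: klms_arm_Suc case_prod_beta Let_def)

declare klms_state.simps(2) [simp del]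

lemma pulls_Suc:
  "pulls K \<omega> (Suc t) b = (if klms_arm K \<omega> (Suc t) = b then Suc (pulls K \<omega> t b) else pulls K \<omega> t b)"
  by (simp add: klms_state_Suc Let_def)

lemma klms_reward_Suc:
  "klms_reward K \<omega> (Suc t) = \<omega> (Inl (klms_arm K \<omega> (Suc t), pulls K \<omega> t (klms_arm K \<omega> (Suc t))))"
  by (simp add: klms_reward_def case_prod_beta Let_def)

lemma totals_eq_part_sum: "totals K \<omega> t b = part_sum \<omega> b (pulls K \<omega> t b)"
  by (induction t) (auto simp: part_sum_def klms_state_Suc Let_def)

lemma klms_sample_range:
  assumes "1 \<le> K"
  shows "klms_sample K w u \<in> {1..K}"
proof (cases "\<exists>a\<in>{1..K}. u < (\<Sum>b=1..a. w b) / (\<Sum>b=1..K. w b)")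
  case True
  then have "\<exists>a. a \<in> {1..K} \<and> u < (\<Sum>b=1..a. w b) / (\<Sum>b=1..K. w b)" by blast
  from LeastI_ex[OF this] show ?thesis using True by (simp add: klms_sample_def)
qed (use assms in \<open>simp add: klms_sample_def\<close>)

lemma klms_arm_range:
  assumes "1 \<le> K"
  shows "klms_arm K \<omega> (Suc t) \<in> {1..K}"
  using klms_sample_range[OF assms] by (auto simp: klms_arm_Suc klms_choice_def)

lemma klms_arm_forced: "Suc t \<le> K \<Longrightarrow> klms_arm K \<omega> (Suc t) = Suc t"
  by (simp add: klms_arm_Suc klms_choice_def)

lemma pulls_forced:
  "t \<le> K \<Longrightarrow> pulls K \<omega> t b = (if 1 \<le> b \<and> b \<le> t then 1 else 0)"
  by (induction t) (auto simp: pulls_Suc klms_arm_forced)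

lemma pulls_mono: "s \<le> t \<Longrightarrow> pulls K \<omega> s b \<le> pulls K \<omega> t b"
  by (induction t rule: dec_induct) (auto simp: pulls_Suc)

lemma pulls_pos: "K \<le> t \<Longrightarrow> b \<in> {1..K} \<Longrightarrow> 1 \<le> pulls K \<omega> t b"
  using pulls_mono[of K t K \<omega> b] by (simp add: pulls_forced)

lemma pulls_le: "pulls K \<omega> t b \<le> t"
  by (induction t) (auto simp: pulls_Suc)

text \<open>Each \<open>s\<close> below the final count is the count just before exactly one pull of
  \<open>a\<close>. Sums over rounds with random counts become sums over counts, where deviation
  bounds for fixed counts apply.\<close>

lemma sum_over_pulls:
  fixes f :: "nat \<Rightarrow> real"
  shows "(\<Sum>t<T. if klms_arm K \<omega> (Suc t) = a then f (pulls K \<omega> t a) else 0) = (\<Sum>s<pulls K \<omega> T a. f s)"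
  by (induction T) (auto simp: pulls_Suc)

text \<open>Independence in functional form: earlier states do not read the uniform variable of
  round \<open>t\<close>.\<close>

lemma klms_state_upd_Inr:
  "s < t \<Longrightarrow> klms_state K (\<omega> (Inr t := x)) s = klms_state K \<omega> s"
  by (induction s) (auto simp: klms_state_Suc klms_arm_Suc Let_def)

text \<open>While \<open>a\<close> has been pulled at most \<open>n\<close> times, only its rewards
  with index below \<open>n\<close> have been read.\<close>

lemma klms_state_upd_Inl:
  "pulls K \<omega> t a \<le> n \<Longrightarrow> klms_state K (\<omega> (Inl (a, n) := x)) t = klms_state K \<omega> t"
proof (induction t)
  case (Suc t)
  have "pulls K \<omega> t a \<le> n" using Suc.prems pulls_mono[of t "Suc t"] by (meson le_SucI le_refl order_trans)
  with Suc.IH have eq: "klms_state K (\<omega> (Inl (a, n) := x)) t = klms_state K \<omega> t" .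
  then have arm: "klms_arm K (\<omega> (Inl (a, n) := x)) (Suc t) = klms_arm K \<omega> (Suc t)"
    by (simp add: klms_arm_Suc)
  let ?b = "klms_arm K \<omega> (Suc t)"
  \<comment> \<open>A pull of \<open>a\<close> in this round raises its count to at most
    \<open>n\<close>, so the reward read has index below \<open>n\<close> and is not the altered
    one.\<close>
  have "?b = a \<Longrightarrow> pulls K \<omega> t a < n"
    using Suc.prems by (simp add: pulls_Suc)
  then have "(\<omega> (Inl (a, n) := x)) (Inl (?b, pulls K \<omega> t ?b)) = \<omega> (Inl (?b, pulls K \<omega> t ?b))"
    by auto
  then show ?case by (simp add: klms_state_Suc Let_def eq arm del: fun_upd_apply)
qed simp

lemma klms_pull_event_upd_Inl:
  "(klms_arm K (\<omega> (Inl (a, n) := x)) (Suc t) = b \<and> pulls K (\<omega> (Inl (a, n) := x)) t a = n)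
     \<longleftrightarrow> (klms_arm K \<omega> (Suc t) = b \<and> pulls K \<omega> t a = n)"
proof -
  \<comment> \<open>Setting the coordinate back to its old value gives the converse
    direction.\<close>
  have imp: "klms_state K \<omega> t = klms_state K (\<omega> (Inl (a, n) := x)) t"
    if "pulls K (\<omega> (Inl (a, n) := x)) t a = n"
    using klms_state_upd_Inl[of K "\<omega> (Inl (a, n) := x)" t a n "\<omega> (Inl (a, n))"] that by simp
  have "klms_state K \<omega> t = klms_state K (\<omega> (Inl (a, n) := x)) t"
    if "pulls K \<omega> t a = n" using klms_state_upd_Inl[of K \<omega> t a n x] that by simp
  then show ?thesis using imp by (auto simp: klms_arm_Suc)
qed

section \<open>Empirical means and sampling weights along a path\<close>

definition emp_mean :: "(nat \<times> nat + nat \<Rightarrow> real) \<Rightarrow> nat \<Rightarrow> nat \<Rightarrow> real" where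
  "emp_mean \<omega> a n = part_sum \<omega> a n / real n"

lemma emp_mean_range:
  assumes "\<And>i. \<omega> (Inl (a, i)) \<in> {0..1}"
  shows "emp_mean \<omega> a n \<in> {0..1}"
proof -
  have "0 \<le> part_sum \<omega> a n" unfolding part_sum_def using assms by (intro sum_nonneg) auto
  moreover have "part_sum \<omega> a n \<le> (\<Sum>i<n. 1)"
    unfolding part_sum_def using assms by (intro sum_mono) auto
  ultimately show ?thesis by (auto simp: emp_mean_def divide_le_eq)
qed

definition emp_max :: "nat \<Rightarrow> (nat \<times> nat + nat \<Rightarrow> real) \<Rightarrow> nat \<Rightarrow> real" where
  "emp_max K \<omega> t = Max ((\<lambda>b. emp_mean \<omega> b (pulls K \<omega> t b)) ` {1..K})"

abbreviation state_weight :: "nat \<Rightarrow> (nat \<times> nat + nat \<Rightarrow> real) \<Rightarrow> nat \<Rightarrow> nat \<Rightarrow> real" where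
  "state_weight K \<omega> t \<equiv> klms_weight K (pulls K \<omega> t) (totals K \<omega> t)"

lemma state_weight_eq:
  "state_weight K \<omega> t a =
     (let d = kl (emp_mean \<omega> a (pulls K \<omega> t a)) (emp_max K \<omega> t)
      in if d = \<infinity> then 0 else exp (- real (pulls K \<omega> t a) * real_of_ereal d))"
  by (simp add: klms_weight_def emp_max_def emp_mean_def totals_eq_part_sum Let_def)

lemma state_weight_nonneg: "0 \<le> state_weight K \<omega> t a"
  by (simp add: state_weight_eq Let_def)

lemma emp_mean_le_emp_max: "a \<in> {1..K} \<Longrightarrow> emp_mean \<omega> a (pulls K \<omega> t a) \<le> emp_max K \<omega> t"
  unfolding emp_max_def by (intro Max_ge) auto

text \<open>An arm attaining the empirical maximum has divergence 0 and hence weight 1.\<close>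

lemma state_weight_sum_ge_1:
  assumes "1 \<le> K"
  shows "1 \<le> (\<Sum>b=1..K. state_weight K \<omega> t b)"
proof -
  have "emp_max K \<omega> t \<in> (\<lambda>b. emp_mean \<omega> b (pulls K \<omega> t b)) ` {1..K}"
    unfolding emp_max_def using assms by (intro Max_in) auto
  then obtain b where b: "b \<in> {1..K}" "emp_mean \<omega> b (pulls K \<omega> t b) = emp_max K \<omega> t" by force
  then have "state_weight K \<omega> t b = 1"
    by (simp add: state_weight_eq kl_eq)
  moreover have "state_weight K \<omega> t b \<le> (\<Sum>b=1..K. state_weight K \<omega> t b)"
    using b by (intro member_le_sum state_weight_nonneg) auto
  ultimately show ?thesis by simp
qed

lemma state_weight_le_1:
  assumes "a \<in> {1..K}" "\<And>b i. b \<in> {1..K} \<Longrightarrow> \<omega> (Inl (b, i)) \<in> {0..1}"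
  shows "state_weight K \<omega> t a \<le> 1"
proof -
  let ?p = "emp_mean \<omega> a (pulls K \<omega> t a)" and ?q = "emp_max K \<omega> t"
  have p: "0 \<le> ?p" "?p \<le> 1" using emp_mean_range[of \<omega> a] assms by auto
  have le: "?p \<le> ?q" using emp_mean_le_emp_max assms by auto
  have q: "?q \<le> 1" unfolding emp_max_def using assms emp_mean_range by (subst Max_le_iff) auto
  have "0 \<le> klr ?p ?q" if "kl ?p ?q \<noteq> \<infinity>"
  \<comment> \<open>At a maximum of 0 or 1, finiteness forces the empirical mean to coincide with
    it, and the divergence is 0.\<close>
  proof (cases "?q = 0 \<or> ?q = 1")
    case True
    then show ?thesis using that p le q by (auto simp: kl_eq split: if_splits)
  next
    case False
    then show ?thesis using p le q by (intro klr_nonneg) auto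
  qed
  then show ?thesis
    by (auto simp: state_weight_eq Let_def kl_eq zero_le_mult_iff)
qed

text \<open>An infinite divergence gives weight 0. Otherwise the interval from the empirical mean to
  the maximum contains the one from \<open>\<theta>\<close> to \<open>c\<close>, and
  \<open>klr_mono\<close> applies.\<close>

lemma state_weight_le_exp:
  assumes "a \<in> {1..K}" "\<And>b i. b \<in> {1..K} \<Longrightarrow> \<omega> (Inl (b, i)) \<in> {0..1}"
    and th: "0 < \<theta>" "\<theta> \<le> c" "emp_mean \<omega> a (pulls K \<omega> t a) < \<theta>" "c \<le> emp_max K \<omega> t"
    and "u \<le> pulls K \<omega> t a" "\<kappa> \<le> klr \<theta> c" "0 \<le> \<kappa>"
  shows "state_weight K \<omega> t a \<le> exp (- real u * \<kappa>)"
proof -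
  let ?p = "emp_mean \<omega> a (pulls K \<omega> t a)" and ?q = "emp_max K \<omega> t"
  have p: "0 \<le> ?p" "?p \<le> 1" using emp_mean_range[of \<omega> a] assms by auto
  have q: "?q \<le> 1" unfolding emp_max_def using assms emp_mean_range by (subst Max_le_iff) auto
  show ?thesis
  proof (cases "kl ?p ?q = \<infinity>")
    case True
    then show ?thesis by (simp add: state_weight_eq)
  next
    case False
    then have "?q \<noteq> 1" using th q by (auto simp: kl_eq split: if_splits)
    then have "klr \<theta> c \<le> klr ?p ?q" using p q th by (intro klr_mono) auto
    then have "real u * \<kappa> \<le> real (pulls K \<omega> t a) * klr ?p ?q"
      using assms by (intro mult_mono) auto
    then show ?thesis using False by (auto simp: state_weight_eq Let_def kl_eq)
  qed
qed

text \<open>Replacing the maximum by the larger \<open>c\<close> can only increase the divergence of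
  an arm below it. The resulting bound involves the empirical mean of \<open>a\<close>
  alone.\<close>

lemma state_weight_ge_exp:
  assumes "a \<in> {1..K}" "\<And>b i. b \<in> {1..K} \<Longrightarrow> \<omega> (Inl (b, i)) \<in> {0..1}"
    and c: "emp_max K \<omega> t < c" "c < 1"
  shows "exp (- real (pulls K \<omega> t a) * klr (emp_mean \<omega> a (pulls K \<omega> t a)) c) \<le> state_weight K \<omega> t a"
proof -
  let ?p = "emp_mean \<omega> a (pulls K \<omega> t a)" and ?q = "emp_max K \<omega> t"
  have p: "0 \<le> ?p" "?p \<le> 1" using emp_mean_range[of \<omega> a] assms by auto
  have le: "?p \<le> ?q" using emp_mean_le_emp_max assms by auto
  have "klr ?p ?q \<le> klr ?p c"
  proof (cases "?q = 0")
    case True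
    then have "?p = 0" using p le by simp
    then show ?thesis using True c klr_nonneg[of 0 c] by simp
  next
    case False
    then have "klr ?p ?q + klr ?q c \<le> klr ?p c" "0 \<le> klr ?q c"
      using p le c by (auto intro!: klr_superadditive klr_nonneg)
    then show ?thesis by simp
  qed
  moreover have "kl ?p ?q \<noteq> \<infinity>" using p le c by (auto simp: kl_eq)
  ultimately show ?thesis
    by (auto simp: state_weight_eq Let_def kl_eq mult_left_mono)
qed

section \<open>Measurability and resampling of one coordinate\<close>

lemma measurable_xlx [measurable (raw)]:
  assumes [measurable]: "f \<in> borel_measurable M" "g \<in> borel_measurable M"
  shows "(\<lambda>x. xlx (f x) (g x)) \<in> borel_measurable M"
  unfolding xlx_def by measurable

lemma measurable_kl [measurable (raw)]:
  assumes [measurable]: "f \<in> borel_measurable M" "g \<in> borel_measurable M"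
  shows "(\<lambda>x. kl (f x) (g x)) \<in> borel_measurable M"
  unfolding kl_def by measurable

lemma measurable_klms_weight:
  assumes [measurable]: "\<And>b. (\<lambda>x. N x b) \<in> measurable M (count_space UNIV)"
    "\<And>b. (\<lambda>x. S x b) \<in> borel_measurable M"
  shows "(\<lambda>x. klms_weight K (N x) (S x) a) \<in> borel_measurable M"
  unfolding klms_weight_def Let_def by measurable

lemma measurable_klms_sample:
  assumes [measurable]: "\<And>b. (\<lambda>x. w x b) \<in> borel_measurable M" "u \<in> borel_measurable M"
  shows "(\<lambda>x. klms_sample K (w x) (u x)) \<in> measurable M (count_space UNIV)"
  unfolding klms_sample_def by measurable

lemma measurable_klms_choice:
  assumes [measurable]: "\<And>b. (\<lambda>x. N x b) \<in> measurable M (count_space UNIV)"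
    "\<And>b. (\<lambda>x. S x b) \<in> borel_measurable M" "u \<in> borel_measurable M"
  shows "(\<lambda>x. klms_choice K (N x) (S x) (u x) t) \<in> measurable M (count_space UNIV)"
  unfolding klms_choice_def
  using measurable_klms_sample[OF measurable_klms_weight[OF assms(1,2)] assms(3)] by simp

text \<open>Inserting an independent fresh value at coordinate \<open>i\<close> reproduces the
  product measure, and Fubini integrates that coordinate first. This identity does the work of
  conditioning on all other coordinates.\<close>

lemma integral_PiM_resample:
  fixes M :: "'i \<Rightarrow> 'a measure" and H :: "('i \<Rightarrow> 'a) \<Rightarrow> real"
  assumes M: "\<And>i. prob_space (M i)" and H: "integrable (PiM UNIV M) H"
  shows "(\<integral>\<omega>. H \<omega> \<partial>PiM UNIV M) = (\<integral>\<omega>. (\<integral>x. H (\<omega> (i := x)) \<partial>M i) \<partial>PiM UNIV M)"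
proof -
  let ?Q = "PiM UNIV M"
  interpret C: prob_space "M i" by (rule M)
  interpret Q: prob_space ?Q by (intro prob_space_PiM M)
  interpret pair_prob_space "M i" ?Q ..
  have upd: "(\<lambda>p. (snd p)(i := fst p)) \<in> measurable (M i \<Otimes>\<^sub>M ?Q) ?Q"
    by (rule measurable_fun_upd[where J=UNIV]) auto
  have distr: "distr (M i \<Otimes>\<^sub>M ?Q) ?Q (\<lambda>p. (snd p)(i := fst p)) = ?Q"
    using distr_pair_PiM_eq_PiM[of UNIV M i] M unfolding split_beta' by simp
  have Hm: "H \<in> borel_measurable ?Q" using H by (rule borel_measurable_integrable)
  have int: "integrable (M i \<Otimes>\<^sub>M ?Q) (\<lambda>p. H ((snd p)(i := fst p)))"
    using H unfolding integrable_distr_eq[OF upd Hm, unfolded distr] .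
  have "(\<integral>\<omega>. H \<omega> \<partial>?Q) = (\<integral>p. H ((snd p)(i := fst p)) \<partial>(M i \<Otimes>\<^sub>M ?Q))"
    using integral_distr[OF upd Hm] unfolding distr .
  also have "\<dots> = (\<integral>\<omega>. (\<integral>x. H (\<omega> (i := x)) \<partial>M i) \<partial>?Q)"
    using integral_snd[of "\<lambda>x X. H (X(i := x))"] int unfolding split_beta' by metis
  finally show ?thesis .
qed

section \<open>Sampling an arm by inversion\<close>

lemma sum_atLeastAtMost_minus:
  fixes w :: "nat \<Rightarrow> real"
  assumes "1 \<le> a"
  shows "(\<Sum>b=1..a. w b) - (\<Sum>b=1..a - 1. w b) = w a"
  using assms by (cases a) auto

text \<open>The exceptional points allow for the default value of the sampler: 1 is a null set, and
  points outside the unit interval carry no mass.\<close>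

lemma uniform01_measure_le:
  assumes "A \<in> sets borel" "A \<subseteq> {l..r} \<union> {1} \<union> {x. x \<notin> {0..1}}" "l \<le> r"
  shows "measure (uniform_measure lborel {0..1::real}) A \<le> r - l"
proof -
  have "emeasure (uniform_measure lborel {0..1::real}) A = emeasure lborel ({0..1} \<inter> A)"
    using assms by (subst emeasure_uniform_measure) (auto simp: divide_ennreal_def)
  also have "\<dots> \<le> emeasure lborel ({l..r} \<union> {1})"
    using assms by (intro emeasure_mono) auto
  also have "\<dots> \<le> emeasure lborel {l..r} + emeasure lborel {1::real}"
    by (rule emeasure_subadditive) (auto simp: sets_lborel)
  also have "\<dots> = ennreal (r - l)" using assms by simp
  finally show ?thesis using assms by (simp add: measure_def enn2real_leI)
qed

lemma uniform01_measure_ge: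
  assumes "A \<in> sets borel" "{0..<r} \<subseteq> A" "0 \<le> r" "r \<le> 1"
  shows "r \<le> measure (uniform_measure lborel {0..1::real}) A"
proof -
  interpret prob_space "uniform_measure lborel {0..1::real}"
    by (intro prob_space_uniform_measure) auto
  have "ennreal r = emeasure lborel {0..<r}" using assms by simp
  also have "\<dots> \<le> emeasure lborel ({0..1} \<inter> A)"
    using assms by (intro emeasure_mono) auto
  also have "\<dots> = emeasure (uniform_measure lborel {0..1::real}) A"
    using assms by (subst emeasure_uniform_measure) (auto simp: divide_ennreal_def)
  also have "\<dots> = ennreal (measure (uniform_measure lborel {0..1::real}) A)"
    by (rule emeasure_eq_measure)
  finally show ?thesis by (simp add: ennreal_le_iff)
qed

lemma klms_sample_prob_le:
  assumes w: "\<And>b. 0 \<le> w b" and W: "0 < (\<Sum>b=1..K. w b)" and a: "a \<in> {1..K}"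
  shows "measure (uniform_measure lborel {0..1::real}) {u. klms_sample K w u = a} \<le> w a / (\<Sum>b=1..K. w b)"
proof -
  define F where "F i = (\<Sum>b=1..i. w b) / (\<Sum>b=1..K. w b)" for i
  have [measurable]: "(\<lambda>u. klms_sample K w u) \<in> measurable borel (count_space UNIV)"
    by (rule measurable_klms_sample) auto
  \<comment> \<open>By leastness \<open>F (a - 1) \<le> u\<close> and \<open>u < F a\<close>; for
    \<open>a = 1\<close> the lower end is \<open>F 0 = 0\<close>.\<close>
  have sub: "u \<in> {F (a - 1)..F a} \<union> {1} \<union> {x. x \<notin> {0..1}}" if u: "klms_sample K w u = a" for u
  proof (cases "\<exists>i\<in>{1..K}. u < F i")
    case True
    let ?Q = "\<lambda>i. i \<in> {1..K} \<and> u < F i"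
    have a_eq: "a = (LEAST i. ?Q i)"
      using u True by (simp add: klms_sample_def F_def)
    have "\<exists>i. ?Q i" using True by blast
    then have Qa: "?Q a" unfolding a_eq by (rule LeastI_ex[of ?Q])
    moreover have "F (a - 1) \<le> u \<or> u < 0"
    proof (cases "a = 1")
      case True
      then show ?thesis by (auto simp: F_def)
    next
      case False
      have "\<not> ?Q (a - 1)"
      proof (rule not_less_Least[of _ ?Q])
        show "a - 1 < (LEAST i. ?Q i)" using a False a_eq[symmetric] by simp
      qed
      then show ?thesis using a False by auto
    qed
    ultimately show ?thesis by auto
  next
    case False
    \<comment> \<open>The cumulative weights end at 1, so the default \<open>K\<close> is reached
      only for \<open>u \<ge> 1\<close>.\<close>
    moreover have "F K = 1" "K \<in> {1..K}" using W a by (auto simp: F_def)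
    ultimately have "1 \<le> u" by force
    then show ?thesis by auto
  qed
  have diff: "F a - F (a - 1) = w a / (\<Sum>b=1..K. w b)"
    unfolding F_def using sum_atLeastAtMost_minus[of a w] a by (simp flip: diff_divide_distrib)
  also have "0 \<le> \<dots>" using w W by simp
  finally have "F (a - 1) \<le> F a" by simp
  moreover have "{u. klms_sample K w u = a} \<subseteq> {F (a - 1)..F a} \<union> {1} \<union> {x. x \<notin> {0..1}}"
    using sub by blast
  moreover have "{u. klms_sample K w u = a} \<in> sets borel" by measurable
  ultimately have "measure (uniform_measure lborel {0..1::real}) {u. klms_sample K w u = a} \<le> F a - F (a - 1)"
    by (intro uniform01_measure_le)
  then show ?thesis using diff by simp
qed

text \<open>For the change of measure to arm 1. As 1 is the smallest index, \<open>u\<close> below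
  its normalised weight already decides the sample.\<close>

lemma klms_sample_prob_1_ge:
  assumes w: "\<And>b. 0 \<le> w b" and W: "0 < (\<Sum>b=1..K. w b)" and K: "1 \<le> K"
  shows "w 1 / (\<Sum>b=1..K. w b) \<le> measure (uniform_measure lborel {0..1::real}) {u. klms_sample K w u = 1}"
proof -
  have [measurable]: "(\<lambda>u. klms_sample K w u) \<in> measurable borel (count_space UNIV)"
    by (rule measurable_klms_sample) auto
  define r where "r = w 1 / (\<Sum>b=1..K. w b)"
  have "klms_sample K w u = 1" if "u < r" for u
  proof -
    let ?Q = "\<lambda>a. a \<in> {1..K} \<and> u < (\<Sum>b=1..a. w b) / (\<Sum>b=1..K. w b)"
    have "(\<Sum>b=1..1. w b) / (\<Sum>b=1..K. w b) = r" by (simp add: r_def)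
    then have *: "?Q 1" using that K by (simp only: atLeastAtMost_iff le_refl simp_thms)
    have "(LEAST a. ?Q a) = 1"
    proof (rule Least_equality)
      show "?Q 1" by (rule *)
      show "1 \<le> a" if "?Q a" for a
        using conjunct1[OF that] by (rule atLeastAtMost_iff[THEN iffD1, THEN conjunct1])
    qed
    moreover have "\<exists>a\<in>{1..K}. u < (\<Sum>b=1..a. w b) / (\<Sum>b=1..K. w b)"
      using * by blast
    ultimately show ?thesis unfolding klms_sample_def by (simp only: if_True)
  qed
  then have sub: "{0..<r} \<subseteq> {u. klms_sample K w u = 1}" by auto
  have "w 1 \<le> (\<Sum>b=1..K. w b)" using w K by (intro member_le_sum[of 1 "{1..K}" w]) auto
  then have r: "0 \<le> r" "r \<le> 1" unfolding r_def using w[of 1] W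
    by (auto intro: divide_nonneg_pos simp only: pos_divide_le_eq mult_1)
  have "{u. klms_sample K w u = 1} \<in> sets borel" by measurable
  from uniform01_measure_ge[OF this sub r] show ?thesis unfolding r_def .
qed

section \<open>The probability space of the bandit\<close>

locale klms_bandit =
  fixes K :: nat and nu :: "nat \<Rightarrow> real measure"
  assumes K2: "2 \<le> K"
    and prob_space_arm: "\<And>a. a \<in> {1..K} \<Longrightarrow> prob_space (nu a)"
    and sets_arm: "\<And>a. a \<in> {1..K} \<Longrightarrow> sets (nu a) = sets borel"
    and arm_unit: "\<And>a. a \<in> {1..K} \<Longrightarrow> measure (nu a) {0..1} = 1"
begin

definition coord :: "nat \<times> nat + nat \<Rightarrow> real measure" where
  "coord = case_sum (\<lambda>(a, n). if a \<in> {1..K} then nu a else return borel 0)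
               (\<lambda>t. uniform_measure lborel {0..1})"

abbreviation P :: "(nat \<times> nat + nat \<Rightarrow> real) measure" where
  "P \<equiv> bandit_space K nu"

abbreviation \<mu> :: "nat \<Rightarrow> real" where
  "\<mu> \<equiv> arm_mean nu"

lemma P_eq: "P = PiM UNIV coord"
  by (simp add: bandit_space_def coord_def)

lemma coord_Inl: "a \<in> {1..K} \<Longrightarrow> coord (Inl (a, n)) = nu a"
  by (simp add: coord_def)

lemma coord_Inr: "coord (Inr t) = uniform_measure lborel {0..1}"
  by (simp add: coord_def)

lemma prob_space_coord: "prob_space (coord i)"
  by (auto simp: coord_def prob_space_arm split: sum.splits
      intro!: prob_space_return prob_space_uniform_measure)

lemma sets_coord [measurable_cong]: "sets (coord i) = sets borel"
  by (auto simp: coord_def sets_arm split: sum.splits)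

sublocale prob_space P
  unfolding P_eq by (intro prob_space_PiM prob_space_coord)

lemma measurable_coord [measurable]: "(\<lambda>\<omega>. \<omega> i) \<in> borel_measurable P"
proof -
  have "(\<lambda>\<omega>. \<omega> i) \<in> measurable P (coord i)"
    unfolding P_eq by (rule measurable_component_singleton) simp
  then show ?thesis by (simp add: measurable_cong_sets[OF refl sets_coord])
qed

lemma integral_resample:
  fixes H :: "_ \<Rightarrow> real"
  assumes "integrable P H"
  shows "(\<integral>\<omega>. H \<omega> \<partial>P) = (\<integral>\<omega>. (\<integral>x. H (\<omega> (i := x)) \<partial>coord i) \<partial>P)"
  using assms unfolding P_eq by (intro integral_PiM_resample prob_space_coord)

lemma measurable_klms_state:
  "(\<forall>b. (\<lambda>\<omega>. pulls K \<omega> t b) \<in> measurable P (count_space UNIV)) \<and>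
   (\<forall>b. (\<lambda>\<omega>. totals K \<omega> t b) \<in> borel_measurable P)"
proof (induction t)
  case (Suc t)
  have [measurable]: "(\<lambda>\<omega>. pulls K \<omega> t b) \<in> measurable P (count_space UNIV)"
    "(\<lambda>\<omega>. totals K \<omega> t b) \<in> borel_measurable P" for b
    using Suc by auto
  have [measurable]: "(\<lambda>\<omega>. klms_arm K \<omega> (Suc t)) \<in> measurable P (count_space UNIV)"
    unfolding klms_arm_Suc by (intro measurable_klms_choice) measurable
  have 1: "(\<lambda>\<omega>. pulls K \<omega> (Suc t) b) \<in> measurable P (count_space UNIV)" for b
    unfolding pulls_Suc by measurable
  have 2: "(\<lambda>\<omega>. totals K \<omega> (Suc t) b) \<in> borel_measurable P" for b
  proof -
    have [measurable]: "(\<lambda>\<omega>. \<omega> (Inl (b, pulls K \<omega> t b))) \<in> borel_measurable P"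
      by (rule measurable_compose_countable[where f="\<lambda>n \<omega>. \<omega> (Inl (b, n))"]) measurable
    have "(\<lambda>\<omega>. totals K \<omega> (Suc t) b) = (\<lambda>\<omega>. if klms_arm K \<omega> (Suc t) = b
        then totals K \<omega> t b + \<omega> (Inl (b, pulls K \<omega> t b)) else totals K \<omega> t b)"
      by (rule ext) (simp add: klms_state_Suc Let_def)
    also have "\<dots> \<in> borel_measurable P" by measurable
    finally show ?thesis .
  qed
  show ?case using 1 2 by blast
qed simp

lemma measurable_pulls [measurable]: "(\<lambda>\<omega>. pulls K \<omega> t b) \<in> measurable P (count_space UNIV)"
  and measurable_totals [measurable]: "(\<lambda>\<omega>. totals K \<omega> t b) \<in> borel_measurable P"
  using measurable_klms_state by blast+

lemma measurable_klms_arm [measurable]: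
  "(\<lambda>\<omega>. klms_arm K \<omega> (Suc t)) \<in> measurable P (count_space UNIV)"
  unfolding klms_arm_Suc by (rule measurable_klms_choice) measurable

lemma measurable_state_weight [measurable]:
  "(\<lambda>\<omega>. state_weight K \<omega> t a) \<in> borel_measurable P"
  by (rule measurable_klms_weight) measurable

lemma measurable_part_sum [measurable]: "(\<lambda>\<omega>. part_sum \<omega> a n) \<in> borel_measurable P"
  unfolding part_sum_def by measurable

lemma measurable_emp_mean [measurable]: "(\<lambda>\<omega>. emp_mean \<omega> a n) \<in> borel_measurable P"
  unfolding emp_mean_def by measurable

lemma measurable_emp_mean_pulls [measurable]:
  "(\<lambda>\<omega>. emp_mean \<omega> a (pulls K \<omega> t b)) \<in> borel_measurable P"
  by (rule measurable_compose_countable[where f="\<lambda>n \<omega>. emp_mean \<omega> a n"]) measurable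

lemma measurable_emp_max [measurable]: "(\<lambda>\<omega>. emp_max K \<omega> t) \<in> borel_measurable P"
  unfolding emp_max_def by measurable

lemma AE_coord_unit:
  assumes "a \<in> {1..K}"
  shows "AE x in nu a. x \<in> {0..1}"
proof -
  interpret A: prob_space "nu a" using assms by (rule prob_space_arm)
  show ?thesis using arm_unit[OF assms] sets_arm[OF assms] by (intro A.AE_prob_1) auto
qed

text \<open>The pathwise weight bounds want all rewards in the unit interval; for countably many
  coordinates this holds outside one null set.\<close>

lemma AE_rewards_unit: "AE \<omega> in P. \<forall>b\<in>{1..K}. \<forall>i. \<omega> (Inl (b, i)) \<in> {0..1}"
proof -
  have "AE \<omega> in P. \<omega> (Inl (b, i)) \<in> {0..1}" if "b \<in> {1..K}" for b i
  proof -
    have "AE x in coord (Inl (b, i)). x \<in> {0..1}"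
      unfolding coord_Inl[OF that] by (rule AE_coord_unit[OF that])
    then show ?thesis
      unfolding P_eq by (intro AE_PiM_component[of UNIV coord "Inl (b, i)"] prob_space_coord) simp_all
  qed
  then show ?thesis by (simp add: AE_ball_countable AE_all_countable)
qed

lemma arm_integrable:
  assumes "a \<in> {1..K}"
  shows "integrable (nu a) (\<lambda>x. x)"
proof -
  interpret A: prob_space "nu a" using assms by (rule prob_space_arm)
  have [measurable_cong]: "sets (nu a) = sets borel" by (rule sets_arm[OF assms])
  show ?thesis
  proof (rule A.integrable_const_bound[where B=1])
    show "AE x in nu a. norm x \<le> 1" using AE_coord_unit[OF assms] by eventually_elim auto
    show "(\<lambda>x. x) \<in> borel_measurable (nu a)" by (rule measurable_ident_sets[OF sets_arm[OF assms]])
  qed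
qed

lemma arm_mean_unit:
  assumes "a \<in> {1..K}"
  shows "0 \<le> \<mu> a" "\<mu> a \<le> 1"
proof -
  interpret A: prob_space "nu a" using assms by (rule prob_space_arm)
  show "0 \<le> \<mu> a" unfolding arm_mean_def
    using AE_coord_unit[OF assms] by (intro integral_nonneg_AE) (auto elim!: eventually_mono)
  have "\<mu> a \<le> (\<integral>x. 1 \<partial>nu a)" unfolding arm_mean_def
    using AE_coord_unit[OF assms] arm_integrable[OF assms]
    by (intro integral_mono_AE) (auto elim!: eventually_mono)
  then show "\<mu> a \<le> 1" by (simp add: A.prob_space)
qed

text \<open>Resampling the uniform variable of round \<open>t + 1\<close> changes neither \<open>F\<close> nor the weights.\<close>

lemma
  assumes t: "K \<le> t" and a: "a \<in> {1..K}"
    and [measurable]: "F \<in> borel_measurable P" and F: "\<And>\<omega>. 0 \<le> F \<omega>" "\<And>\<omega>. F \<omega> \<le> B"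
    and inv: "\<And>\<omega> x. F (\<omega> (Inr (Suc t) := x)) = F \<omega>"
  defines "p \<equiv> \<lambda>\<omega>. state_weight K \<omega> t a / (\<Sum>b=1..K. state_weight K \<omega> t b)"
  shows arm_prob_le: "(\<integral>\<omega>. (if klms_arm K \<omega> (Suc t) = a then F \<omega> else 0) \<partial>P) \<le> (\<integral>\<omega>. p \<omega> * F \<omega> \<partial>P)"
    and arm_1_prob_ge: "a = 1 \<Longrightarrow> (\<integral>\<omega>. p \<omega> * F \<omega> \<partial>P) \<le> (\<integral>\<omega>. (if klms_arm K \<omega> (Suc t) = a then F \<omega> else 0) \<partial>P)"
proof -
  let ?U = "uniform_measure lborel {0..1::real}"
  interpret U: prob_space ?U by (intro prob_space_uniform_measure) auto
  \<comment> \<open>\<open>q\<close> is the conditional probability that the sampler returns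
    \<open>a\<close> given all coordinates but this round's uniform variable; \<open>p\<close> is
    the normalised weight it is compared with.\<close>
  define q where "q \<omega> = measure ?U {u. klms_sample K (state_weight K \<omega> t) u = a}" for \<omega>
  have [measurable]: "p \<in> borel_measurable P" unfolding p_def by measurable
  have B: "0 \<le> B" using F[of undefined] by linarith
  have W: "1 \<le> (\<Sum>b=1..K. state_weight K \<omega> t b)" for \<omega>
    using state_weight_sum_ge_1 K2 by simp
  have p0: "0 \<le> p \<omega>" for \<omega>
    unfolding p_def by (intro divide_nonneg_nonneg sum_nonneg state_weight_nonneg)
  have p1: "p \<omega> \<le> 1" for \<omega>
  proof -
    have "state_weight K \<omega> t a \<le> (\<Sum>b=1..K. state_weight K \<omega> t b)"
      using a by (intro member_le_sum state_weight_nonneg) auto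
    then show ?thesis using W[of \<omega>] by (simp add: p_def divide_le_eq)
  qed
  have int_p: "integrable P (\<lambda>\<omega>. p \<omega> * F \<omega>)"
  proof (intro integrable_const_bound[where B=B] AE_I2)
    fix \<omega>
    have "p \<omega> * F \<omega> \<le> 1 * B" using F p0 p1 B by (intro mult_mono) auto
    then show "norm (p \<omega> * F \<omega>) \<le> B" using F p0 by simp
  qed measurable
  have int_H: "integrable P (\<lambda>\<omega>. if klms_arm K \<omega> (Suc t) = a then F \<omega> else 0)"
    using F B by (intro integrable_const_bound[where B=B] AE_I2) (auto)
  have inner: "(\<integral>x. (if klms_arm K (\<omega> (Inr (Suc t) := x)) (Suc t) = a
      then F (\<omega> (Inr (Suc t) := x)) else 0) \<partial>coord (Inr (Suc t))) = q \<omega> * F \<omega>" for \<omega>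
  proof -
    have arm: "klms_arm K (\<omega> (Inr (Suc t) := x)) (Suc t) = klms_sample K (state_weight K \<omega> t) x" for x
      using t by (simp add: klms_arm_Suc klms_state_upd_Inr klms_choice_def)
    have [measurable]: "(\<lambda>u. klms_sample K (state_weight K \<omega> t) u) \<in> measurable borel (count_space UNIV)"
      by (rule measurable_klms_sample) auto
    have "(\<integral>x. (if klms_sample K (state_weight K \<omega> t) x = a then F \<omega> else 0) \<partial>?U)
        = (\<integral>x. F \<omega> * indicator {u. klms_sample K (state_weight K \<omega> t) u = a} x \<partial>?U)"
      by (intro Bochner_Integration.integral_cong) auto
    also have "\<dots> = F \<omega> * q \<omega>" by (simp add: q_def)
    finally show ?thesis unfolding arm inv coord_Inr by (simp only: mult.commute)
  qed
  have eq: "(\<integral>\<omega>. (if klms_arm K \<omega> (Suc t) = a then F \<omega> else 0) \<partial>P) = (\<integral>\<omega>. q \<omega> * F \<omega> \<partial>P)"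
    by (subst integral_resample[OF int_H, of "Inr (Suc t)"]) (simp only: inner)
  have ql: "q \<omega> \<le> p \<omega>" for \<omega>
    unfolding q_def p_def using W[of \<omega>] a
    by (intro klms_sample_prob_le state_weight_nonneg) auto
  show "(\<integral>\<omega>. (if klms_arm K \<omega> (Suc t) = a then F \<omega> else 0) \<partial>P) \<le> (\<integral>\<omega>. p \<omega> * F \<omega> \<partial>P)"
    unfolding eq
  proof (rule integral_mono'[OF int_p])
    show "q \<omega> * F \<omega> \<le> p \<omega> * F \<omega>" for \<omega> by (intro mult_right_mono ql F)
    show "0 \<le> p \<omega> * F \<omega>" for \<omega> by (intro mult_nonneg_nonneg p0 F)
  qed
  show "(\<integral>\<omega>. p \<omega> * F \<omega> \<partial>P) \<le> (\<integral>\<omega>. (if klms_arm K \<omega> (Suc t) = a then F \<omega> else 0) \<partial>P)" if "a = 1"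
  proof -
    have "p \<omega> \<le> q \<omega>" for \<omega>
      unfolding q_def p_def that using W[of \<omega>] K2
      by (intro klms_sample_prob_1_ge state_weight_nonneg) auto
    then have "p = q" using ql by (intro ext antisym)
    then show ?thesis unfolding eq by simp
  qed
qed

end

section \<open>Deviations of empirical means\<close>

text \<open>The product freezes once it reaches \<open>b\<close>, so a crossing at any time up to
  \<open>n\<close> is still visible at time \<open>n\<close>. Markov's inequality at one fixed time
  thereby becomes a maximal inequality.\<close>

fun stopped_product :: "(real \<Rightarrow> real) \<Rightarrow> real \<Rightarrow> nat \<Rightarrow> (nat \<times> nat + nat \<Rightarrow> real) \<Rightarrow> nat \<Rightarrow> real" where
  "stopped_product Z b a \<omega> 0 = 1"
| "stopped_product Z b a \<omega> (Suc i) =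
     (if b \<le> stopped_product Z b a \<omega> i then stopped_product Z b a \<omega> i
      else stopped_product Z b a \<omega> i * Z (\<omega> (Inl (a, i))))"

lemma stopped_product_upd:
  "n \<le> m \<Longrightarrow> stopped_product Z b a (\<omega> (Inl (a, m) := x)) n = stopped_product Z b a \<omega> n"
  by (induction n) auto

lemma stopped_product_bounds:
  assumes "\<And>y. 0 \<le> Z y" "\<And>y. Z y \<le> B" "1 \<le> B"
  shows "0 \<le> stopped_product Z b a \<omega> n \<and> stopped_product Z b a \<omega> n \<le> B ^ n"
proof (induction n)
  case (Suc n)
  let ?R = "stopped_product Z b a \<omega> n"
  have "?R * 1 \<le> B ^ n * B" using Suc assms by (intro mult_mono) auto
  moreover have "?R * Z (\<omega> (Inl (a, n))) \<le> B ^ n * B" using Suc assms by (intro mult_mono) auto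
  ultimately show ?case using Suc assms by (auto simp: mult.commute)
qed simp

lemma stopped_product_ge:
  assumes "s \<le> n" "b \<le> (\<Prod>i<s. Z (\<omega> (Inl (a, i))))"
  shows "b \<le> stopped_product Z b a \<omega> n"
proof -
  \<comment> \<open>Either nothing has been stopped and the value is the full product, or it is
    frozen at a value at least \<open>b\<close>.\<close>
  have "stopped_product Z b a \<omega> s = (\<Prod>i<s. Z (\<omega> (Inl (a, i)))) \<or> b \<le> stopped_product Z b a \<omega> s"
    by (induction s) auto
  with assms have *: "b \<le> stopped_product Z b a \<omega> s" by auto
  from assms(1) show ?thesis by (induction rule: dec_induct) (use * in auto)
qed

context klms_bandit
begin

lemma space_P [simp]: "space P = UNIV"
proof -
  have "space (coord i) = UNIV" for i
    using sets_eq_imp_space_eq[OF sets_coord] by simp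
  then show ?thesis by (simp add: P_eq space_PiM PiE_UNIV_domain)
qed

lemma events_Collect:
  assumes "Measurable.pred P Q"
  shows "{\<omega>. Q \<omega>} \<in> events"
  using assms by (simp add: pred_def)

lemma measurable_stopped_product [measurable]:
  assumes [measurable]: "Z \<in> borel_measurable borel"
  shows "(\<lambda>\<omega>. stopped_product Z b a \<omega> n) \<in> borel_measurable P"
proof (induction n)
  case (Suc n)
  note [measurable] = Suc measurable_compose[OF measurable_coord assms]
  show ?case unfolding stopped_product.simps by measurable
qed simp

text \<open>The last reward is integrated out first: the earlier product does not depend on it, and
  the new factor has mean 1 or is absent. The bound \<open>B\<close> secures integrability.\<close>

lemma expectation_stopped_product:
  assumes a: "a \<in> {1..K}" and Zm: "Z \<in> borel_measurable borel"
    and Z: "\<And>y. 0 \<le> Z y" "\<And>y. Z y \<le> B" "1 \<le> B" "(\<integral>y. Z y \<partial>nu a) = 1"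
  shows "integrable P (\<lambda>\<omega>. stopped_product Z b a \<omega> n) \<and> (\<integral>\<omega>. stopped_product Z b a \<omega> n \<partial>P) = 1"
proof -
  let ?R = "stopped_product Z b a"
  interpret A: prob_space "nu a" using a by (rule prob_space_arm)
  have Zm': "Z \<in> borel_measurable (nu a)"
    using Zm measurable_cong_sets[OF sets_arm[OF a] refl] by blast
  have int: "integrable P (\<lambda>\<omega>. ?R \<omega> n)" for n
  proof (rule integrable_const_bound[where B="B ^ n"])
    show "AE \<omega> in P. norm (?R \<omega> n) \<le> B ^ n"
      using stopped_product_bounds[of Z B b a _ n] Z by (intro AE_I2) (simp add: abs_of_nonneg)
    show "(\<lambda>\<omega>. ?R \<omega> n) \<in> borel_measurable P"
      by (rule measurable_stopped_product[OF Zm])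
  qed
  have intZ: "integrable (nu a) Z"
  proof (rule A.integrable_const_bound[where B=B])
    show "AE y in nu a. norm (Z y) \<le> B" using Z by (intro AE_I2) simp
  qed (rule Zm')
  have "(\<integral>\<omega>. ?R \<omega> n \<partial>P) = 1"
  proof (induction n)
    case (Suc n)
    have inner: "(\<integral>x. ?R (\<omega> (Inl (a, n) := x)) (Suc n) \<partial>coord (Inl (a, n))) = ?R \<omega> n" for \<omega>
    proof -
      have "(\<integral>x. ?R (\<omega> (Inl (a, n) := x)) (Suc n) \<partial>coord (Inl (a, n)))
          = (\<integral>x. (if b \<le> ?R \<omega> n then ?R \<omega> n else ?R \<omega> n * Z x) \<partial>nu a)"
        unfolding coord_Inl[OF a] stopped_product.simps
        by (simp only: stopped_product_upd[OF order_refl] fun_upd_same)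
      also have "\<dots> = ?R \<omega> n"
        using intZ Z(4) by (cases "b \<le> ?R \<omega> n") (simp_all add: A.prob_space)
      finally show ?thesis .
    qed
    show ?case
      by (subst integral_resample[OF int, where i="Inl (a, n)"]) (simp only: inner Suc)
  qed (use prob_space in simp)
  then show ?thesis using int by blast
qed

text \<open>Betting on an arm: the wealth process with factors \<open>y e\<^sup>p + (1 - y) e\<^sup>q\<close> is a martingale, and
  it dominates the exponential of the log-likelihood ratio by convexity of \<open>exp\<close>.\<close>

lemma betting_tail:
  assumes a: "a \<in> {1..K}" and fair: "\<mu> a * exp p + (1 - \<mu> a) * exp q = 1"
  shows "prob {\<omega>. \<exists>s\<le>m. v \<le> part_sum \<omega> a s * p + (real s - part_sum \<omega> a s) * q} \<le> exp (- v)"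
proof -
  \<comment> \<open>Clamping makes the factors nonnegative and bounded for every real reward and
    changes nothing on the unit interval.\<close>
  define cl :: "real \<Rightarrow> real" where "cl y = max 0 (min 1 y)" for y
  define Z where "Z y = cl y * exp p + (1 - cl y) * exp q" for y
  define B where "B = 1 + exp p + exp q"
  have cl: "0 \<le> cl y" "cl y \<le> 1" for y by (auto simp: cl_def)
  have Zm: "Z \<in> borel_measurable borel" unfolding Z_def cl_def by measurable
  have Z0: "0 \<le> Z y" for y
    unfolding Z_def using cl by (intro add_nonneg_nonneg mult_nonneg_nonneg) auto
  have ZB: "Z y \<le> B" for y
  proof -
    have "cl y * exp p \<le> 1 * exp p" "(1 - cl y) * exp q \<le> 1 * exp q"
      by (rule mult_right_mono; use cl[of y] in simp)+
    then show ?thesis unfolding Z_def B_def by linarith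
  qed
  have B1: "1 \<le> B" by (simp add: B_def)
  interpret A: prob_space "nu a" using a by (rule prob_space_arm)
  have ZE: "(\<integral>y. Z y \<partial>nu a) = 1"
  proof -
    have "(\<integral>y. Z y \<partial>nu a) = (\<integral>y. exp q + y * (exp p - exp q) \<partial>nu a)"
    proof (rule integral_cong_AE)
      show "Z \<in> borel_measurable (nu a)"
        using Zm measurable_cong_sets[OF sets_arm[OF a] refl] by blast
      show "(\<lambda>y. exp q + y * (exp p - exp q)) \<in> borel_measurable (nu a)"
        using arm_integrable[OF a] by (intro borel_measurable_integrable) simp
      show "AE y in nu a. Z y = exp q + y * (exp p - exp q)"
        using AE_coord_unit[OF a] by eventually_elim (simp add: Z_def cl_def algebra_simps)
    qed
    also have "\<dots> = exp q + \<mu> a * (exp p - exp q)"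
      using arm_integrable[OF a] by (simp add: arm_mean_def A.prob_space)
    also have "\<dots> = 1" using fair by (simp add: algebra_simps)
    finally show ?thesis .
  qed
  let ?E = "{\<omega>. \<exists>s\<le>m. v \<le> part_sum \<omega> a s * p + (real s - part_sum \<omega> a s) * q}"
  let ?R = "\<lambda>\<omega>. stopped_product Z (exp v) a \<omega> m"
  have R: "integrable P ?R" "(\<integral>\<omega>. ?R \<omega> \<partial>P) = 1"
    using expectation_stopped_product[OF a Zm Z0 ZB B1 ZE] by auto
  have Rm [measurable]: "?R \<in> borel_measurable P" by (rule measurable_stopped_product[OF Zm])
  have "AE \<omega> in P. \<omega> \<in> ?E \<longrightarrow> \<omega> \<in> {\<omega>. exp v \<le> ?R \<omega>}"
    using AE_rewards_unit
  proof eventually_elim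
    case (elim \<omega>)
    have unit: "0 \<le> \<omega> (Inl (a, i))" "\<omega> (Inl (a, i)) \<le> 1" for i using elim a by auto
    show ?case
    proof
      assume "\<omega> \<in> ?E"
      then obtain s where s: "s \<le> m" "v \<le> part_sum \<omega> a s * p + (real s - part_sum \<omega> a s) * q" by blast
      have fac: "exp (\<omega> (Inl (a, i)) * p + (1 - \<omega> (Inl (a, i))) * q) \<le> Z (\<omega> (Inl (a, i)))" for i
      proof -
        let ?y = "\<omega> (Inl (a, i))"
        have "exp ((1 - ?y) *\<^sub>R q + ?y *\<^sub>R p) \<le> (1 - ?y) * exp q + ?y * exp p"
          using unit by (intro convex_onD[OF exp_convex]) auto
        moreover have "cl ?y = ?y" using unit[of i] by (simp add: cl_def)
        ultimately show ?thesis by (simp add: Z_def add.commute)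
      qed
      have "exp v \<le> exp (\<Sum>i<s. \<omega> (Inl (a, i)) * p + (1 - \<omega> (Inl (a, i))) * q)"
        using s by (simp add: part_sum_def sum.distrib sum_subtractf flip: sum_distrib_right)
      also have "\<dots> = (\<Prod>i<s. exp (\<omega> (Inl (a, i)) * p + (1 - \<omega> (Inl (a, i))) * q))"
        by (simp add: exp_sum)
      also have "\<dots> \<le> (\<Prod>i<s. Z (\<omega> (Inl (a, i))))" using fac by (intro prod_mono) auto
      finally show "\<omega> \<in> {\<omega>. exp v \<le> ?R \<omega>}"
        using stopped_product_ge[OF s(1)] by blast
    qed
  qed
  then have "prob ?E \<le> prob {\<omega>. exp v \<le> ?R \<omega>}"
    by (rule finite_measure_mono_AE) (rule events_Collect, measurable)
  \<comment> \<open>Markov's inequality at the fixed time \<open>m\<close>, where the expected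
    wealth is still 1.\<close>
  also have "\<dots> \<le> 1 / exp v"
    using integral_Markov_inequality_measure[OF R(1), of "{}" "exp v"] R(2)
      stopped_product_bounds[of Z B] Z0 ZB B1 by simp
  finally show ?thesis by (simp add: exp_minus inverse_eq_divide)
qed

text \<open>The bet uses the log-likelihood ratios of Bernoulli mean \<open>x\<close> against
  Bernoulli mean \<open>\<mu> a\<close>, which is fair. Its payoff per pull is affine in the
  empirical mean, equals \<open>klr x (\<mu> a)\<close> at \<open>x\<close> and grows away from
  \<open>\<mu> a\<close>, so a deviation at any \<open>s \<ge> n\<close> earns at least
  \<open>n * klr x (\<mu> a)\<close>. Both tails and whole blocks of counts are covered at
  once.\<close>

lemma kl_tail:
  assumes a: "a \<in> {1..K}" and x: "0 < x" "x < 1" and \<mu>: "0 < \<mu> a" "\<mu> a < 1"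
    and E: "E \<in> events" and n: "1 \<le> n"
    and sub: "\<And>\<omega>. \<omega> \<in> E \<Longrightarrow> \<forall>i. \<omega> (Inl (a, i)) \<in> {0..1} \<Longrightarrow> \<exists>s\<in>{n..m}.
      (x \<le> \<mu> a \<and> emp_mean \<omega> a s \<le> x \<or> \<mu> a \<le> x \<and> x \<le> emp_mean \<omega> a s)"
  shows "prob E \<le> exp (- real n * klr x (\<mu> a))"
proof -
  define p where "p = ln (x / \<mu> a)"
  define q where "q = ln ((1 - x) / (1 - \<mu> a))"
  have fair: "\<mu> a * exp p + (1 - \<mu> a) * exp q = 1"
    using x \<mu> by (simp add: p_def q_def)
  have klx: "klr x (\<mu> a) = x * p + (1 - x) * q" by (simp add: klr_def p_def q_def)
  have kl0: "0 \<le> klr x (\<mu> a)" using x \<mu> by (intro klr_nonneg) auto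
  let ?v = "real n * klr x (\<mu> a)"
  let ?E = "{\<omega>. \<exists>s\<le>m. ?v \<le> part_sum \<omega> a s * p + (real s - part_sum \<omega> a s) * q}"
  have "AE \<omega> in P. \<omega> \<in> E \<longrightarrow> \<omega> \<in> ?E"
    using AE_rewards_unit
  proof eventually_elim
    case (elim \<omega>)
    show ?case
    proof
      assume "\<omega> \<in> E"
      moreover have "\<forall>i. \<omega> (Inl (a, i)) \<in> {0..1}" using elim a by blast
      ultimately obtain s where s: "s \<in> {n..m}"
        "x \<le> \<mu> a \<and> emp_mean \<omega> a s \<le> x \<or> \<mu> a \<le> x \<and> x \<le> emp_mean \<omega> a s"
        using sub by blast
      let ?X = "emp_mean \<omega> a s"
      have s0: "0 < real s" using s n by auto
      have X: "part_sum \<omega> a s = real s * ?X" using s0 by (simp add: emp_mean_def)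
      have sgn: "x \<le> \<mu> a \<Longrightarrow> p \<le> 0 \<and> 0 \<le> q" "\<mu> a \<le> x \<Longrightarrow> 0 \<le> p \<and> q \<le> 0"
        using x \<mu> by (auto simp: p_def q_def ln_le_zero_iff)
      \<comment> \<open>This is the payoff at \<open>?X\<close> minus the payoff at
        \<open>x\<close>.\<close>
      have "0 \<le> (?X - x) * (p - q)"
        using s(2)
      proof
        assume "x \<le> \<mu> a \<and> ?X \<le> x"
        then show ?thesis using sgn(1) by (intro mult_nonpos_nonpos) auto
      next
        assume "\<mu> a \<le> x \<and> x \<le> ?X"
        then show ?thesis using sgn(2) by (intro mult_nonneg_nonneg) auto
      qed
      then have "klr x (\<mu> a) \<le> ?X * p + (1 - ?X) * q"
        unfolding klx by (simp add: algebra_simps)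
      then have "real n * klr x (\<mu> a) \<le> real s * (?X * p + (1 - ?X) * q)"
        using s s0 kl0 by (intro mult_mono) auto
      also have "\<dots> = part_sum \<omega> a s * p + (real s - part_sum \<omega> a s) * q"
        unfolding X by (simp add: algebra_simps)
      finally show "\<omega> \<in> ?E" using s by auto
    qed
  qed
  moreover have "?E \<in> events" by (rule events_Collect) measurable
  ultimately have "prob E \<le> prob ?E" by (rule finite_measure_mono_AE)
  also have "\<dots> \<le> exp (- ?v)" by (rule betting_tail[OF a fair])
  finally show ?thesis by simp
qed

text \<open>At mean 0 or 1 the likelihood ratios degenerate, but then the reward is almost surely
  constant. The restriction \<open>s > 0\<close> reflects that the empirical mean of no pulls is
  0.\<close>

lemma AE_arm_degenerate:
  assumes a: "a \<in> {1..K}"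
  shows "\<mu> a = 0 \<Longrightarrow> AE \<omega> in P. \<forall>s. emp_mean \<omega> a s = 0"
    and "\<mu> a = 1 \<Longrightarrow> AE \<omega> in P. \<forall>s>0. emp_mean \<omega> a s = 1"
proof -
  interpret A: prob_space "nu a" using a by (rule prob_space_arm)
  have const: "AE \<omega> in P. \<forall>i. \<omega> (Inl (a, i)) = z" if "AE y in nu a. y = z" for z
  proof -
    have "AE \<omega> in P. \<omega> (Inl (a, i)) = z" for i
    proof -
      have "AE y in coord (Inl (a, i)). y = z" unfolding coord_Inl[OF a] by (rule that)
      then show ?thesis
        unfolding P_eq by (intro AE_PiM_component[of UNIV coord "Inl (a, i)"] prob_space_coord) simp_all
    qed
    then show ?thesis by (simp add: AE_all_countable)
  qed
  \<comment> \<open>A nonnegative variable with integral 0 vanishes almost surely; \<open>c\<close>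
    is 1 at mean 0 and -1 at mean 1.\<close>
  have AEmean: "AE y in nu a. y = z" if "AE y in nu a. 0 \<le> (y - z) * c" "\<mu> a = z" "c \<noteq> 0" for z c :: real
  proof -
    have int: "integrable (nu a) (\<lambda>y. (y - z) * c)"
      using arm_integrable[OF a] by simp
    have "(\<integral>y. (y - z) * c \<partial>nu a) = 0"
      using arm_integrable[OF a] that by (simp add: arm_mean_def A.prob_space)
    then have "AE y in nu a. (y - z) * c = 0"
      using integral_nonneg_eq_0_iff_AE[OF int that(1)] by simp
    then show ?thesis using that(3) by simp
  qed
  show "AE \<omega> in P. \<forall>s. emp_mean \<omega> a s = 0" if "\<mu> a = 0"
  proof -
    have "AE y in nu a. y = 0"
      using AE_coord_unit[OF a] that by (intro AEmean[of 0 1]) auto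
    from const[OF this] show ?thesis by eventually_elim (simp add: emp_mean_def part_sum_def)
  qed
  show "AE \<omega> in P. \<forall>s>0. emp_mean \<omega> a s = 1" if "\<mu> a = 1"
  proof -
    have "AE y in nu a. y = 1"
      using AE_coord_unit[OF a] that by (intro AEmean[of 1 "-1"]) auto
    from const[OF this] show ?thesis by eventually_elim (simp add: emp_mean_def part_sum_def)
  qed
qed

lemma prob_emp_mean_ge:
  assumes a: "a \<in> {1..K}" and \<theta>: "\<mu> a < \<theta>" "\<theta> < 1" and s: "1 \<le> s"
    and \<kappa>: "0 < \<mu> a \<Longrightarrow> \<kappa> \<le> klr \<theta> (\<mu> a)"
  shows "prob {\<omega>. \<theta> \<le> emp_mean \<omega> a s} \<le> exp (- real s * \<kappa>)"
proof (cases "\<mu> a = 0")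
  case True
  have "AE \<omega> in P. \<not> \<theta> \<le> emp_mean \<omega> a s"
    using AE_arm_degenerate(1)[OF a True] by eventually_elim (use \<theta> True in auto)
  then have "prob {\<omega>. \<theta> \<le> emp_mean \<omega> a s} = 0" using prob_eq_0_AE by fastforce
  then show ?thesis by simp
next
  case False
  then have pos: "0 < \<mu> a" using arm_mean_unit[OF a] by simp
  have "{\<omega>. \<theta> \<le> emp_mean \<omega> a s} \<in> events" by (rule events_Collect) measurable
  then have "prob {\<omega>. \<theta> \<le> emp_mean \<omega> a s} \<le> exp (- real s * klr \<theta> (\<mu> a))"
    using \<theta> pos s by (intro kl_tail[OF a, where m=s]) auto
  also have "\<dots> \<le> exp (- real s * \<kappa>)" using \<kappa>[OF pos] by (simp add: mult_left_mono)
  finally show ?thesis .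
qed

text \<open>The level \<open>y\<close> is lowered by \<open>1/n\<close> so that the tilted mean stays away from \<open>0\<close>.\<close>

lemma prob_emp_mean_lt_kl_ge:
  assumes a: "a \<in> {1..K}" and c: "0 < c" "c < \<mu> a" and n: "1 \<le> n" and y: "0 \<le> y"
    and \<kappa>: "\<mu> a < 1 \<Longrightarrow> \<kappa> \<le> klr c (\<mu> a)"
  shows "prob {\<omega>. \<exists>s\<in>{n..m}. emp_mean \<omega> a s < c \<and> y \<le> klr (emp_mean \<omega> a s) c}
    \<le> exp (1 - real n * (y + \<kappa>))" (is "prob ?E \<le> _")
proof (cases "\<mu> a = 1")
  case True
  have "AE \<omega> in P. \<omega> \<notin> ?E"
    using AE_arm_degenerate(2)[OF a True] by eventually_elim (use c n True in auto)
  then have "prob ?E = 0" using prob_eq_0_AE[of "\<lambda>\<omega>. \<omega> \<in> ?E"] by simp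
  then show ?thesis by simp
next
  case False
  then have \<mu>1: "\<mu> a < 1" using arm_mean_unit[OF a] by simp
  have c1: "c < 1" using c \<mu>1 by simp
  have [measurable]: "(\<lambda>\<omega>. klr (emp_mean \<omega> a s) c) \<in> borel_measurable P" for s
    unfolding klr_def by measurable
  have Em: "?E \<in> events" by (rule events_Collect) measurable
  define y' where "y' = max 0 (y - 1 / real n)"
  have y'y: "y' < y \<or> y' = 0" "0 \<le> y'" "y - 1 / real n \<le> y'" using n by (auto simp: y'_def max_def)
  show ?thesis
  \<comment> \<open>If the lowered level is attained at some \<open>x > 0\<close>, the event pushes
    the empirical mean down to \<open>x\<close> and \<open>kl_tail\<close> applies. Otherwise the
    event is null.\<close>
  proof (cases "\<exists>x. 0 < x \<and> x \<le> c \<and> klr x c = y'")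
    case True
    then obtain x where x: "0 < x" "x \<le> c" "klr x c = y'" by blast
    have "prob ?E \<le> exp (- real n * klr x (\<mu> a))"
    proof (rule kl_tail[OF a x(1) _ _ \<mu>1 Em n])
      fix \<omega> assume \<omega>: "\<omega> \<in> ?E" "\<forall>i. \<omega> (Inl (a, i)) \<in> {0..1}"
      then obtain s where s: "s \<in> {n..m}" "emp_mean \<omega> a s < c" "y \<le> klr (emp_mean \<omega> a s) c" by blast
      have "emp_mean \<omega> a s \<le> x"
      proof (rule ccontr)
        let ?X = "emp_mean \<omega> a s"
        assume "\<not> ?X \<le> x"
        then have X: "x < ?X" by simp
        then have "klr x ?X + klr ?X c \<le> klr x c"
          using x s c1 by (intro klr_superadditive) auto
        \<comment> \<open>Only strict positivity of \<open>klr x ?X\<close> matters here; it makes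
          the divergence from \<open>c\<close> strictly smaller at \<open>?X\<close> than at
          \<open>x\<close>.\<close>
        moreover have "(?X - x)\<^sup>2 / (2 * 1) \<le> klr x ?X"
        proof (rule klr_quadratic_lower)
          fix z assume "x \<le> z" "z \<le> ?X"
          then have "z * (1 - z) \<le> 1 * 1" using x s c1 by (intro mult_mono) auto
          then show "z * (1 - z) \<le> 1" by simp
        qed (use x X s c1 in auto)
        moreover have "0 < (?X - x)\<^sup>2 / (2 * 1)" using X by simp
        ultimately have "y < y'" using s(3) x(3) by linarith
        then show False using y'y y by auto
      qed
      then show "\<exists>s\<in>{n..m}. x \<le> \<mu> a \<and> emp_mean \<omega> a s \<le> x \<or> \<mu> a \<le> x \<and> x \<le> emp_mean \<omega> a s"
        using s x c by force
    qed (use x c c1 in auto)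
    \<comment> \<open>Lowering the level by \<open>1 / n\<close> costs
      \<open>n * (1 / n) = 1\<close> in the exponent.\<close>
    also have "real n * (y + \<kappa>) - 1 \<le> real n * klr x (\<mu> a)"
    proof -
      have "klr x c + klr c (\<mu> a) \<le> klr x (\<mu> a)"
        using x c \<mu>1 by (intro klr_superadditive) auto
      then have "y - 1 / real n + \<kappa> \<le> klr x (\<mu> a)" using \<kappa>[OF \<mu>1] x y'y by linarith
      then have "real n * (y - 1 / real n + \<kappa>) \<le> real n * klr x (\<mu> a)"
        by (rule mult_left_mono) simp
      moreover have "real n * (y - 1 / real n + \<kappa>) = real n * (y + \<kappa>) - 1"
        using n by (simp add: field_simps)
      ultimately show ?thesis by simp
    qed
    then have "exp (- real n * klr x (\<mu> a)) \<le> exp (1 - real n * (y + \<kappa>))" by simp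
    finally show ?thesis .
  next
    case no: False
    have "y' \<noteq> 0" using no c by (metis klr_self order_refl)
    \<comment> \<open>By the intermediate value theorem an unattained level is at least
      \<open>klr 0 c\<close>, the largest divergence of a mean below \<open>c\<close>. No empirical
      mean then reaches \<open>y > y'\<close>.\<close>
    have "klr 0 c \<le> y'"
    proof (rule ccontr)
      assume "\<not> klr 0 c \<le> y'"
      then have "\<exists>x\<ge>0. x \<le> c \<and> klr x c = y'"
        using y'y c continuous_on_klr[OF c(1) c1] by (intro IVT2') auto
      then obtain x where "0 \<le> x" "x \<le> c" "klr x c = y'" by blast
      moreover from this have "x \<noteq> 0" using \<open>\<not> klr 0 c \<le> y'\<close> by auto
      ultimately show False using no by auto
    qed
    have "AE \<omega> in P. \<omega> \<notin> ?E"
      using AE_rewards_unit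
    proof eventually_elim
      case (elim \<omega>)
      show ?case
      proof
        assume "\<omega> \<in> ?E"
        then obtain s where s: "emp_mean \<omega> a s < c" "y \<le> klr (emp_mean \<omega> a s) c" by blast
        have X: "0 \<le> emp_mean \<omega> a s" using emp_mean_range[of \<omega> a s] elim a by auto
        have "klr (emp_mean \<omega> a s) c \<le> klr 0 c"
        proof (cases "emp_mean \<omega> a s = 0")
          case False
          then show ?thesis using X s c1 by (intro klr_mono) auto
        qed simp
        then show False using s \<open>klr 0 c \<le> y'\<close> \<open>y' \<noteq> 0\<close> y'y by auto
      qed
    qed
    then have "prob ?E = 0" using prob_eq_0_AE[of "\<lambda>\<omega>. \<omega> \<in> ?E"] by simp
    then show ?thesis by simp
  qed
qed

end

section \<open>Underestimation of the best arm\<close>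

lemma sum_exp_neg_le:
  fixes \<kappa> :: real
  assumes "0 < \<kappa>"
  shows "(\<Sum>s=1..T. exp (- real s * \<kappa>)) \<le> 1 / \<kappa>"
proof -
  \<comment> \<open>The sharper bound telescopes: \<open>1 + \<kappa> \<le> exp \<kappa>\<close>
    bounds each term by the decrease of the exponential divided by \<open>\<kappa>\<close>.\<close>
  have "(\<Sum>s=1..T. exp (- real s * \<kappa>)) \<le> (1 - exp (- real T * \<kappa>)) / \<kappa>"
  proof (induction T)
    case (Suc T)
    let ?E = "exp (- real (Suc T) * \<kappa>)"
    have "exp (- real T * \<kappa>) = ?E * exp \<kappa>"
      by (simp add: algebra_simps flip: exp_add)
    moreover have "?E * (1 + \<kappa>) \<le> ?E * exp \<kappa>"
      by (intro mult_left_mono) auto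
    ultimately have "?E * \<kappa> \<le> exp (- real T * \<kappa>) - ?E" by (simp only: distrib_left mult_1_right)
    then have "?E \<le> (exp (- real T * \<kappa>) - ?E) / \<kappa>" using assms by (simp only: pos_le_divide_eq)
    moreover have "(1 - exp (- real T * \<kappa>)) / \<kappa> + (exp (- real T * \<kappa>) - ?E) / \<kappa> = (1 - ?E) / \<kappa>"
      by (simp only: add_divide_distrib[symmetric]) simp
    moreover have "(\<Sum>s=1..Suc T. exp (- real s * \<kappa>)) = (\<Sum>s=1..T. exp (- real s * \<kappa>)) + ?E"
      by (rule sum.cl_ivl_Suc[THEN trans]) simp
    ultimately show ?case using Suc by linarith
  qed simp
  also have "\<dots> \<le> 1 / \<kappa>" using assms by (intro divide_right_mono) auto
  finally show ?thesis .
qed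

lemma sum_inverse_sqrt_le:
  "(\<Sum>s=1..n. 1 / sqrt (real s)) \<le> 2 * sqrt (real n)"
proof (induction n)
  case (Suc n)
  define u v where "u = sqrt (real n)" and "v = sqrt (real (Suc n))"
  have v: "0 < v" and uv: "u \<le> v" by (auto simp: u_def v_def)
  \<comment> \<open>Each term is at most the increment \<open>2 * (v - u)\<close> of the right-hand
    side.\<close>
  have "1 = (v - u) * (v + u)"
    by (simp add: u_def v_def algebra_simps flip: power2_eq_square)
  also have "\<dots> \<le> (v - u) * (2 * v)" using uv by (intro mult_left_mono) auto
  finally have "1 \<le> 2 * (v - u) * v" by (simp only: mult_ac)
  then have "1 / v \<le> 2 * (v - u)" using v by (simp only: pos_divide_le_eq)
  moreover have "(\<Sum>s=1..Suc n. 1 / sqrt (real s)) = (\<Sum>s=1..n. 1 / sqrt (real s)) + 1 / v"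
    by (simp add: v_def)
  moreover have "(\<Sum>s=1..n. 1 / sqrt (real s)) \<le> 2 * u" using Suc by (simp only: u_def)
  ultimately have "(\<Sum>s=1..Suc n. 1 / sqrt (real s)) \<le> 2 * u + 2 * (v - u)" by (simp only: add_mono)
  also have "\<dots> = 2 * v" by simp
  finally show ?case by (simp only: v_def)
qed simp

lemma sum_inverse_sqrt_capped_le:
  fixes \<kappa> :: real
  assumes "0 < \<kappa>"
  shows "(\<Sum>s=1..T. if real s * \<kappa> \<le> 1 then 1 / sqrt (real s * \<kappa>) else 0) \<le> 2 / \<kappa>"
proof -
  define n where "n = nat \<lfloor>1 / \<kappa>\<rfloor>"
  have n: "real n \<le> 1 / \<kappa>" using assms by (simp add: n_def)
  have "(\<Sum>s=1..T. if real s * \<kappa> \<le> 1 then 1 / sqrt (real s * \<kappa>) else 0)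
      = (\<Sum>s\<in>{s\<in>{1..T}. real s * \<kappa> \<le> 1}. 1 / sqrt (real s * \<kappa>))"
    by (rule sum.inter_filter[symmetric]) simp
  also have "\<dots> \<le> (\<Sum>s=1..n. 1 / sqrt (real s * \<kappa>))"
  proof (rule sum_mono2)
    show "{s\<in>{1..T}. real s * \<kappa> \<le> 1} \<subseteq> {1..n}"
    proof
      fix s assume s: "s \<in> {s\<in>{1..T}. real s * \<kappa> \<le> 1}"
      then have "real s \<le> 1 / \<kappa>" using assms by (simp add: pos_le_divide_eq)
      then have "s \<le> n" unfolding n_def by (simp add: le_nat_floor)
      then show "s \<in> {1..n}" using s by simp
    qed
  qed (use assms in auto)
  also have "\<dots> = (\<Sum>s=1..n. 1 / sqrt (real s)) / sqrt \<kappa>"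
    by (simp add: real_sqrt_mult sum_divide_distrib)
  also have "\<dots> \<le> (2 * sqrt (real n)) / sqrt \<kappa>"
    using assms by (intro divide_right_mono sum_inverse_sqrt_le) auto
  also have "\<dots> \<le> (2 * sqrt (1 / \<kappa>)) / sqrt \<kappa>"
    using n assms by (intro divide_right_mono mult_left_mono real_sqrt_le_mono) auto
  also have "\<dots> = 2 / \<kappa>"
    using assms by (simp add: real_sqrt_divide)
  finally show ?thesis .
qed

lemma ln_le_2_sqrt: "ln x \<le> 2 * sqrt x" if "0 < x" for x :: real
proof -
  have "ln (sqrt x) \<le> sqrt x - 1" using that by (intro ln_le_minus_one) simp
  then show ?thesis using that by (simp add: ln_sqrt)
qed

text \<open>Writing \<open>T / s\<close> as \<open>T * \<kappa>\<close> times
  \<open>1 / (s * \<kappa>)\<close> separates \<open>ln (T * \<kappa>)\<close> from a logarithm that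
  is large only for small \<open>s * \<kappa>\<close> and is absorbed by an inverse square root.
  Hence the sum carries \<open>ln (T * \<kappa>)\<close> instead of \<open>ln T\<close>.\<close>

lemma sum_log_exp_neg_le:
  fixes \<kappa> :: real
  assumes \<kappa>: "0 < \<kappa>" and T: "exp 1 \<le> real T * \<kappa>"
  shows "(\<Sum>s=1..T. (1 + 4 * ln (2 * real T / real s)) * exp (- real s * \<kappa>)) \<le> 32 * ln (real T * \<kappa>) / \<kappa>"
proof -
  let ?L = "ln (real T * \<kappa>)"
  have T\<kappa>: "0 < real T * \<kappa>" using T by (meson exp_gt_zero less_le_trans)
  then have T0: "0 < real T" using \<kappa> by (simp add: zero_less_mult_iff)
  have L1: "1 \<le> ?L" using T T\<kappa> by (subst ln_ge_iff) auto
  have bound: "(1 + 4 * ln (2 * real T / real s)) * exp (- real s * \<kappa>)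
      \<le> (8 * ?L + 8) * exp (- real s * \<kappa>) + 8 * (if real s * \<kappa> \<le> 1 then 1 / sqrt (real s * \<kappa>) else 0)"
    if s: "s \<in> {1..T}" for s
  proof -
    let ?z = "real s * \<kappa>"
    have s0: "0 < real s" using s by auto
    have z: "0 < ?z" using s0 \<kappa> by simp
    have "2 * real T / real s = 2 * (real T * \<kappa>) * (1 / ?z)" using \<kappa> s0 by simp
    then have "ln (2 * real T / real s) = ln 2 + ?L + ln (1 / ?z)"
      using T\<kappa> z by (simp only: ln_mult_pos zero_less_numeral zero_less_mult_iff zero_less_divide_1_iff simp_thms)
    moreover have "ln (1 / ?z) \<le> 2 * sqrt (1 / ?z)" using z by (intro ln_le_2_sqrt) simp
    moreover have "sqrt (1 / ?z) = 1 / sqrt ?z" by (simp add: real_sqrt_divide)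
    moreover have "ln (2::real) \<le> 2 - 1" by (rule ln_le_minus_one) simp
    \<comment> \<open>This yields \<open>1 + 4 * ln 2 \<le> 4 \<le> 4 * ?L\<close>.\<close>
    moreover have "4 * ln (2::real) \<le> 3"
    proof -
      have "ln (2::real) \<le> 3 / 4" using ln2_le_25_over_36 by simp
      then show ?thesis by simp
    qed
    ultimately have "1 + 4 * ln (2 * real T / real s) \<le> 8 * ?L + 8 * (1 / sqrt ?z)"
      using L1 by linarith
    then have "(1 + 4 * ln (2 * real T / real s)) * exp (- real s * \<kappa>)
        \<le> (8 * ?L + 8 * (1 / sqrt ?z)) * exp (- real s * \<kappa>)"
      by (rule mult_right_mono) simp
    also have "\<dots> = 8 * ?L * exp (- real s * \<kappa>) + 8 * ((1 / sqrt ?z) * exp (- real s * \<kappa>))"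
      by (simp only: distrib_right mult.assoc)
    also have "(1 / sqrt ?z) * exp (- real s * \<kappa>)
        \<le> exp (- real s * \<kappa>) + (if ?z \<le> 1 then 1 / sqrt ?z else 0)"
    proof (cases "?z \<le> 1")
      case True
      have "(1 / sqrt ?z) * exp (- real s * \<kappa>) \<le> (1 / sqrt ?z) * 1"
        using z by (intro mult_left_mono) auto
      then show ?thesis using True by (simp add: add_increasing)
    next
      case False
      have "(1 / sqrt ?z) * exp (- real s * \<kappa>) \<le> 1 * exp (- real s * \<kappa>)"
        using z False by (intro mult_right_mono) auto
      then show ?thesis using False by simp
    qed
    finally show ?thesis by (simp only: distrib_left distrib_right) linarith
  qed
  have "(\<Sum>s=1..T. (1 + 4 * ln (2 * real T / real s)) * exp (- real s * \<kappa>))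
     \<le> (\<Sum>s=1..T. (8 * ?L + 8) * exp (- real s * \<kappa>)
         + 8 * (if real s * \<kappa> \<le> 1 then 1 / sqrt (real s * \<kappa>) else 0))"
    by (rule sum_mono[OF bound])
  also have "\<dots> = (8 * ?L + 8) * (\<Sum>s=1..T. exp (- real s * \<kappa>))
     + 8 * (\<Sum>s=1..T. if real s * \<kappa> \<le> 1 then 1 / sqrt (real s * \<kappa>) else 0)"
    by (simp only: sum.distrib sum_distrib_left)
  also have "\<dots> \<le> (8 * ?L + 8) * (1 / \<kappa>) + 8 * (2 / \<kappa>)"
    using L1 by (intro add_mono mult_left_mono sum_exp_neg_le sum_inverse_sqrt_capped_le \<kappa>) auto
  also have "\<dots> = (8 * ?L + 24) / \<kappa>" by (simp add: add_divide_distrib)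
  also have "\<dots> \<le> 32 * ?L / \<kappa>" using L1 \<kappa> by (intro divide_right_mono) auto
  finally show ?thesis .
qed

text \<open>Telescoping with \<open>n\<^sup>2 / (1 + (n\<kappa>)\<^sup>2)\<close> along \<open>n = 2\<^sup>j\<close>.\<close>

lemma sum_dyadic_le:
  fixes \<kappa> :: real
  assumes \<kappa>: "0 < \<kappa>"
  shows "(\<Sum>j<N. (2 ^ j)\<^sup>2 * exp (- (2 ^ j) * \<kappa>)) \<le> 1024 / \<kappa>\<^sup>2"
proof -
  define f where "f n = n\<^sup>2 / (1 + (n * \<kappa>)\<^sup>2)" for n :: real
  have step: "n\<^sup>2 * exp (- n * \<kappa>) \<le> 1024 * (f (2 * n) - f n)" if n: "0 < n" for n
  proof -
    define z where "z = n * \<kappa>"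
    have z: "0 \<le> z" using n \<kappa> by (simp add: z_def)
    have "(1 + z / 4) ^ 4 \<le> exp (z / 4) ^ 4" using z by (intro power_mono) auto
    also have "exp (z / 4) ^ 4 = exp z" by (simp flip: exp_of_nat_mult)
    finally have e: "(1 + z / 4) ^ 4 \<le> exp z" .
    \<comment> \<open>The denominators of \<open>f (2 * n)\<close> and \<open>f n\<close> multiply
      to a quartic; in \<open>w = z / 4\<close> its leading coefficient is 1024, and 1024 times the
      fourth power of \<open>1 + w\<close> dominates it coefficientwise.\<close>
    have "(1 + 4 * z\<^sup>2) * (1 + z\<^sup>2) \<le> 1024 * (1 + z / 4) ^ 4"
    proof -
      define w where "w = z / 4"
      have w: "0 \<le> w" "z = 4 * w" using z by (simp_all add: w_def)
      have "(1 + w) ^ 4 = 1 + 4 * w + 6 * w\<^sup>2 + 4 * w ^ 3 + w ^ 4"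
        by (simp add: power4_eq_xxxx power3_eq_cube power2_eq_square algebra_simps)
      moreover have "(1 + 4 * z\<^sup>2) * (1 + z\<^sup>2) = 1 + 80 * w\<^sup>2 + 1024 * w ^ 4"
        unfolding w(2) by (simp add: power4_eq_xxxx power2_eq_square algebra_simps)
      moreover have "0 \<le> w\<^sup>2" "0 \<le> w ^ 3" using w by auto
      ultimately show ?thesis using w(1) unfolding w_def[symmetric] by linarith
    qed
    with e have "(1 + 4 * z\<^sup>2) * (1 + z\<^sup>2) \<le> 1024 * exp z" by linarith
    then have "exp (- z) * ((1 + 4 * z\<^sup>2) * (1 + z\<^sup>2)) \<le> exp (- z) * (1024 * exp z)"
      by (rule mult_left_mono) simp
    also have "\<dots> = 1024" by (simp add: exp_minus)
    finally have "exp (- z) * ((1 + 4 * z\<^sup>2) * (1 + z\<^sup>2)) \<le> 1024" .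
    moreover have pos: "0 < (1 + 4 * z\<^sup>2) * (1 + z\<^sup>2)" by (intro mult_pos_pos add_pos_nonneg) auto
    ultimately have ez: "exp (- z) \<le> 1024 / ((1 + 4 * z\<^sup>2) * (1 + z\<^sup>2))" by (simp only: pos_le_divide_eq)
    have "n\<^sup>2 * exp (- z) \<le> n\<^sup>2 * (1024 / ((1 + 4 * z\<^sup>2) * (1 + z\<^sup>2)))"
      using ez by (intro mult_left_mono) auto
    also have "\<dots> \<le> 1024 * (3 * n\<^sup>2 / ((1 + 4 * z\<^sup>2) * (1 + z\<^sup>2)))"
      using pos by (simp add: divide_right_mono)
    also have "3 * n\<^sup>2 / ((1 + 4 * z\<^sup>2) * (1 + z\<^sup>2)) = f (2 * n) - f n"
    proof -
      have p1: "1 + 4 * z\<^sup>2 \<noteq> 0" and p2: "1 + z\<^sup>2 \<noteq> 0" using pos by auto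
      have "f (2 * n) = 4 * n\<^sup>2 / (1 + 4 * z\<^sup>2)" "f n = n\<^sup>2 / (1 + z\<^sup>2)"
        by (simp_all add: f_def z_def power_mult_distrib mult.assoc)
      then have "f (2 * n) - f n = (4 * n\<^sup>2 * (1 + z\<^sup>2) - n\<^sup>2 * (1 + 4 * z\<^sup>2)) / ((1 + 4 * z\<^sup>2) * (1 + z\<^sup>2))"
        by (simp only: diff_frac_eq[OF p1 p2])
      also have "4 * n\<^sup>2 * (1 + z\<^sup>2) - n\<^sup>2 * (1 + 4 * z\<^sup>2) = 3 * n\<^sup>2" by (simp add: algebra_simps)
      finally show ?thesis by simp
    qed
    finally show ?thesis by (simp add: z_def)
  qed
  have "(\<Sum>j<N. (2 ^ j)\<^sup>2 * exp (- (2 ^ j) * \<kappa>)) \<le> (\<Sum>j<N. 1024 * (f (2 ^ Suc j) - f (2 ^ j)))"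
    using step by (intro sum_mono) simp
  also have "\<dots> = 1024 * (\<Sum>j<N. f (2 ^ Suc j) - f (2 ^ j))" by (rule sum_distrib_left[symmetric])
  also have "(\<Sum>j<N. f (2 ^ Suc j) - f (2 ^ j)) = f (2 ^ N) - f 1"
    using sum_lessThan_telescope[of "\<lambda>j. f (2 ^ j)" N] by simp
  also have "1024 * (f (2 ^ N) - f 1) \<le> 1024 * (1 / \<kappa>\<^sup>2)"
  proof -
    have "f (2 ^ N) \<le> 1 / \<kappa>\<^sup>2"
    proof -
      let ?n = "2 ^ N :: real"
      have "?n\<^sup>2 * \<kappa>\<^sup>2 \<le> 1 * (1 + (?n * \<kappa>)\<^sup>2)" by (simp add: power_mult_distrib)
      moreover have "0 < 1 + (?n * \<kappa>)\<^sup>2" by (intro add_pos_nonneg) auto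
      ultimately show ?thesis unfolding f_def using \<kappa> by (subst frac_le_eq) (auto simp: divide_simps)
    qed
    moreover have "0 \<le> f 1" by (simp add: f_def)
    ultimately show ?thesis by (intro mult_left_mono) auto
  qed
  finally show ?thesis by simp
qed

section \<open>Truncated change of measure to the best arm\<close>

definition kl_level :: "nat \<Rightarrow> nat \<Rightarrow> real" where
  "kl_level T s = 4 * ln (2 * real T / real s) / real s"

text \<open>The exponential is the reciprocal of the lower bound for the weight of arm 1 in
  \<open>state_weight_ge_exp\<close>. The cutoff keeps it below \<open>(2 * T / s) ^ 4\<close> for
  \<open>1 \<le> s \<le> T\<close>.\<close>

definition tilt :: "real \<Rightarrow> nat \<Rightarrow> (nat \<times> nat + nat \<Rightarrow> real) \<Rightarrow> nat \<Rightarrow> real" where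
  "tilt c T \<omega> s = (if emp_mean \<omega> 1 s < c \<and> klr (emp_mean \<omega> 1 s) c < kl_level T s
     then exp (real s * klr (emp_mean \<omega> 1 s) c) else 0)"

lemma tilt_bounds: "0 \<le> tilt c T \<omega> s" "tilt c T \<omega> s \<le> exp (real s * kl_level T s)"
  by (auto simp: tilt_def intro!: mult_left_mono)

context klms_bandit
begin

lemma measurable_klr_emp_mean [measurable]:
  "(\<lambda>\<omega>. klr (emp_mean \<omega> a s) c) \<in> borel_measurable P"
  unfolding klr_def by measurable

lemma measurable_tilt [measurable]: "(\<lambda>\<omega>. tilt c T \<omega> s) \<in> borel_measurable P"
  unfolding tilt_def by measurable

lemma one_arm: "1 \<in> {1..K}"
  using K2 by simp

text \<open>Peeling over dyadic blocks \<open>2\<^sup>j \<le> s < 2\<^sup>j\<^sup>+\<^sup>1\<close>, on each of which \<open>kl_level\<close> is at least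
  \<open>2 ln (T/2\<^sup>j) / 2\<^sup>j\<close>.\<close>

lemma prob_kl_level_exceeded:
  assumes c: "0 < c" "c < \<mu> 1" and \<kappa>: "\<mu> 1 < 1 \<Longrightarrow> \<kappa> \<le> klr c (\<mu> 1)" "0 < \<kappa>"
    and T: "exp 1 \<le> real T * \<kappa>"
  shows "real T * prob {\<omega>. \<exists>s\<in>{1..T}. emp_mean \<omega> 1 s < c \<and> kl_level T s \<le> klr (emp_mean \<omega> 1 s) c}
    \<le> 3072 / \<kappa>" (is "real T * prob ?E \<le> _")
proof -
  have "0 < real T * \<kappa>" using T by (meson exp_gt_zero less_le_trans)
  then have T0: "0 < real T" using \<kappa> by (simp add: zero_less_mult_iff)
  define l where "l j = 2 * ln (real T / 2 ^ j) / 2 ^ j" for j :: nat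
  define B where "B j = {\<omega>. \<exists>s\<in>{2 ^ j..2 ^ Suc j}. emp_mean \<omega> 1 s < c \<and> l j \<le> klr (emp_mean \<omega> 1 s) c}" for j
  define J where "J = {j. (2::nat) ^ j \<le> T}"
  have J: "J \<subseteq> {..<T}"
  proof
    fix j assume "j \<in> J"
    then have "(2::nat) ^ j \<le> T" by (simp add: J_def)
    then show "j \<in> {..<T}" using less_le_trans[OF less_exp] by blast
  qed
  then have Jfin: "finite J" using finite_subset by blast
  have sub: "?E \<subseteq> (\<Union>j\<in>J. B j)"
  proof
    fix \<omega> assume "\<omega> \<in> ?E"
    then obtain s where s: "s \<in> {1..T}" "emp_mean \<omega> 1 s < c" "kl_level T s \<le> klr (emp_mean \<omega> 1 s) c" by blast
    then obtain j where j: "2 ^ j \<le> s" "s < 2 ^ (j + 1)" using ex_power_ivl1[of 2 s] by auto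
    have jJ: "j \<in> J" using j s by (auto simp: J_def)
    have s0: "0 < real s" using s by auto
    have js: "2 ^ j \<le> real s" "real s \<le> 2 * 2 ^ j"
      using of_nat_mono[OF j(1), where 'a=real] of_nat_mono[of s "2 * 2 ^ j", where 'a=real] j(2) by auto
    have Tj: "1 \<le> real T / 2 ^ j" using jJ by (simp add: J_def flip: of_nat_le_iff)
    have "0 \<le> ln (real T / 2 ^ j)" using Tj by simp
    moreover have "ln (real T / 2 ^ j) \<le> ln (2 * real T / real s)"
      using js s0 T0 Tj by (intro ln_mono) (auto simp: divide_simps)
    ultimately have "4 * ln (real T / 2 ^ j) / (2 * 2 ^ j) \<le> 4 * ln (2 * real T / real s) / real s"
      using js s0 by (intro frac_le) auto
    then have "l j \<le> kl_level T s" by (simp add: l_def kl_level_def)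
    then have "l j \<le> klr (emp_mean \<omega> 1 s) c" using s by simp
    then have "\<omega> \<in> B j" unfolding B_def using s(2) j by force
    then show "\<omega> \<in> (\<Union>j\<in>J. B j)" using jJ by blast
  qed
  have Bm: "B j \<in> events" for j unfolding B_def by (rule events_Collect) measurable
  \<comment> \<open>The choice of \<open>l j\<close> gives
    \<open>exp (- (2 ^ j) * l j) = (2 ^ j / T) ^ 2\<close>, so the block probabilities add up to
    order \<open>1 / (T * \<kappa>) ^ 2\<close>.\<close>
  have Bp: "prob (B j) \<le> exp 1 / (real T)\<^sup>2 * ((2 ^ j)\<^sup>2 * exp (- (2 ^ j) * \<kappa>))" if "j \<in> J" for j
  proof -
    have Tj: "1 \<le> real T / 2 ^ j" using that by (simp add: J_def flip: of_nat_le_iff)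
    then have l0: "0 \<le> l j" by (simp add: l_def)
    have "prob (B j) \<le> exp (1 - real (2 ^ j) * (l j + \<kappa>))"
      unfolding B_def by (rule prob_emp_mean_lt_kl_ge[OF one_arm c _ l0 \<kappa>(1)]) auto
    also have "1 - real (2 ^ j) * (l j + \<kappa>) = 1 + (- (2 * ln (real T / 2 ^ j)) + - (2 ^ j) * \<kappa>)"
      by (simp add: l_def algebra_simps)
    also have "exp \<dots> = exp 1 * (exp (- (2 * ln (real T / 2 ^ j))) * exp (- (2 ^ j) * \<kappa>))"
      by (simp only: exp_add)
    also have "exp (- (2 * ln (real T / 2 ^ j))) = (2 ^ j)\<^sup>2 / (real T)\<^sup>2"
    proof -
      have "exp (2 * ln (real T / 2 ^ j)) = (real T / 2 ^ j)\<^sup>2"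
        using T0 by (simp add: exp_double)
      then show ?thesis using T0 by (simp add: exp_minus power_divide)
    qed
    finally show ?thesis by (simp add: mult_ac)
  qed
  have "prob ?E \<le> prob (\<Union>j\<in>J. B j)"
    using Jfin Bm by (intro finite_measure_mono sub) auto
  also have "\<dots> \<le> (\<Sum>j\<in>J. prob (B j))"
    using Jfin Bm by (intro finite_measure_subadditive_finite) auto
  also have "\<dots> \<le> (\<Sum>j\<in>J. exp 1 / (real T)\<^sup>2 * ((2 ^ j)\<^sup>2 * exp (- (2 ^ j) * \<kappa>)))"
    by (rule sum_mono[OF Bp])
  also have "\<dots> \<le> (\<Sum>j<T. exp 1 / (real T)\<^sup>2 * ((2 ^ j)\<^sup>2 * exp (- (2 ^ j) * \<kappa>)))"
    by (rule sum_mono2) (use J in auto)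
  also have "\<dots> \<le> exp 1 / (real T)\<^sup>2 * (1024 / \<kappa>\<^sup>2)"
    unfolding sum_distrib_left[symmetric] by (intro mult_left_mono sum_dyadic_le \<kappa>) auto
  finally have "real T * prob ?E \<le> real T * (exp 1 / (real T)\<^sup>2 * (1024 / \<kappa>\<^sup>2))"
    by (rule mult_left_mono) simp
  \<comment> \<open>One of the two factors \<open>1 / (T * \<kappa>)\<close> absorbs
    \<open>T\<close>; the other is at most 1. The constant 3072 is 3 * 1024.\<close>
  also have "\<dots> = exp 1 * (1024 / \<kappa>) * (1 / (real T * \<kappa>))"
    using T0 \<kappa> by (simp add: power2_eq_square)
  also have "\<dots> \<le> 3 * (1024 / \<kappa>) * 1"
  proof (intro mult_mono)
    have "1 \<le> exp (1::real)" by simp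
    then have "1 \<le> real T * \<kappa>" using T by linarith
    then show "1 / (real T * \<kappa>) \<le> 1" by simp
  qed (use \<kappa> T0 exp_le in auto)
  finally show ?thesis by simp
qed

text \<open>The expectation is split by the integer part \<open>j\<close> of \<open>s\<close> times
  the divergence. Layer \<open>j\<close> contributes at most
  \<open>exp (j + 1) * exp (1 - j - s * \<kappa>)\<close>, independent of \<open>j\<close>, and the
  truncation leaves at most \<open>1 + 4 * ln (2 * T / s)\<close> layers. The exponential factor
  thus costs only a logarithm.\<close>

lemma expectation_tilt_le:
  assumes c: "0 < c" "c < \<mu> 1" and \<kappa>: "\<mu> 1 < 1 \<Longrightarrow> \<kappa> \<le> klr c (\<mu> 1)"
    and s: "s \<in> {1..T}"
  shows "(\<integral>\<omega>. tilt c T \<omega> s \<partial>P) \<le> exp 2 * ((1 + 4 * ln (2 * real T / real s)) * exp (- real s * \<kappa>))"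
proof -
  have s0: "0 < real s" "1 \<le> s" using s by auto
  define N where "N = nat \<lfloor>real s * kl_level T s\<rfloor>"
  have slev: "real s * kl_level T s = 4 * ln (2 * real T / real s)"
    using s0 by (simp add: kl_level_def)
  have "0 \<le> ln (2 * real T / real s)"
    using s by (intro ln_ge_zero) (auto simp: divide_simps)
  then have N: "real N \<le> 4 * ln (2 * real T / real s)"
    unfolding N_def slev by simp
  \<comment> \<open>The one-point block \<open>{s..s}\<close> specialises the maximal bound to a
    single count.\<close>
  define B where "B j = {\<omega>. \<exists>r\<in>{s..s}. emp_mean \<omega> 1 r < c \<and> real j / real s \<le> klr (emp_mean \<omega> 1 r) c}" for j
  have Bm: "B j \<in> events" for j unfolding B_def by (rule events_Collect) measurable
  have Bp: "exp (real j + 1) * prob (B j) \<le> exp 2 * exp (- real s * \<kappa>)" for j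
  proof -
    have "prob (B j) \<le> exp (1 - real s * (real j / real s + \<kappa>))"
      unfolding B_def using s0 by (intro prob_emp_mean_lt_kl_ge[OF one_arm c] \<kappa>) auto
    also have "1 - real s * (real j / real s + \<kappa>) = 1 - real j - real s * \<kappa>"
      using s0 by (simp add: distrib_left)
    finally have "exp (real j + 1) * prob (B j) \<le> exp (real j + 1) * exp (1 - real j - real s * \<kappa>)"
      by (rule mult_left_mono) simp
    also have "\<dots> = exp 2 * exp (- real s * \<kappa>)" by (simp flip: exp_add)
    finally show ?thesis .
  qed
  have "(\<integral>\<omega>. tilt c T \<omega> s \<partial>P) \<le> (\<integral>\<omega>. (\<Sum>j\<le>N. exp (real j + 1) * indicator (B j) \<omega>) \<partial>P)"
  proof (rule integral_mono_AE)
    show "integrable P (\<lambda>\<omega>. tilt c T \<omega> s)"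
      using tilt_bounds by (intro integrable_const_bound[where B="exp (real s * kl_level T s)"] AE_I2)
        (simp_all add: abs_of_nonneg)
    show "integrable P (\<lambda>\<omega>. \<Sum>j\<le>N. exp (real j + 1) * indicator (B j) \<omega>)"
      using Bm by (intro Bochner_Integration.integrable_sum integrable_mult_right) (simp add: emeasure_eq_measure)
    show "AE \<omega> in P. tilt c T \<omega> s \<le> (\<Sum>j\<le>N. exp (real j + 1) * indicator (B j) \<omega>)"
      using AE_rewards_unit
    proof eventually_elim
      case (elim \<omega>)
      let ?X = "emp_mean \<omega> 1 s"
      show ?case
      proof (cases "?X < c \<and> klr ?X c < kl_level T s")
        case True
        have "c < 1" using c arm_mean_unit[OF one_arm] by simp
        moreover have "?X \<in> {0..1}" using elim one_arm by (intro emp_mean_range) blast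
        ultimately have kl0: "0 \<le> klr ?X c" using c by (intro klr_nonneg) auto
        define z where "z = real s * klr ?X c"
        define j where "j = nat \<lfloor>z\<rfloor>"
        have z0: "0 \<le> z" using kl0 by (simp add: z_def)
        have "z \<le> real s * kl_level T s" unfolding z_def using True by (intro mult_left_mono) auto
        then have jN: "j \<le> N" unfolding j_def N_def by (intro nat_mono floor_mono)
        have jz: "real j \<le> z" "z \<le> real j + 1" using z0 unfolding j_def by linarith+
        have "\<omega> \<in> B j" using jz(1) True s0 by (simp add: B_def z_def pos_divide_le_eq mult.commute)
        then have "tilt c T \<omega> s \<le> exp (real j + 1) * indicator (B j) \<omega>"
          using jz True by (simp add: tilt_def z_def)
        also have "\<dots> \<le> (\<Sum>j\<le>N. exp (real j + 1) * indicator (B j) \<omega>)"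
          using jN by (intro member_le_sum[of j "{..N}" "\<lambda>j. exp (real j + 1) * indicator (B j) \<omega>"]) auto
        finally show ?thesis .
      next
        case False
        have "0 \<le> (\<Sum>j\<le>N. exp (real j + 1) * indicator (B j) \<omega>)" by (intro sum_nonneg) simp
        then show ?thesis using False by (auto simp: tilt_def)
      qed
    qed
  qed
  also have "\<dots> = (\<Sum>j\<le>N. exp (real j + 1) * prob (B j))"
    using Bm by (subst Bochner_Integration.integral_sum) (simp_all add: emeasure_eq_measure)
  also have "\<dots> \<le> (\<Sum>j\<le>N. exp 2 * exp (- real s * \<kappa>))" by (rule sum_mono[OF Bp])
  also have "\<dots> = (1 + real N) * (exp 2 * exp (- real s * \<kappa>))" by simp
  also have "\<dots> \<le> (1 + 4 * ln (2 * real T / real s)) * (exp 2 * exp (- real s * \<kappa>))"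
    using N by (intro mult_right_mono) auto
  finally show ?thesis by (simp add: mult_ac)
qed

lemma sum_expectation_tilt_le:
  assumes c: "0 < c" "c < \<mu> 1" and \<kappa>: "\<mu> 1 < 1 \<Longrightarrow> \<kappa> \<le> klr c (\<mu> 1)" "0 < \<kappa>"
    and T: "exp 1 \<le> real T * \<kappa>"
  shows "(\<Sum>s=1..T. \<integral>\<omega>. tilt c T \<omega> s \<partial>P) \<le> 288 * ln (real T * \<kappa>) / \<kappa>"
proof -
  have "(\<Sum>s=1..T. \<integral>\<omega>. tilt c T \<omega> s \<partial>P)
      \<le> (\<Sum>s=1..T. exp 2 * ((1 + 4 * ln (2 * real T / real s)) * exp (- real s * \<kappa>)))"
    by (rule sum_mono[OF expectation_tilt_le[OF c \<kappa>(1)]])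
  also have "\<dots> \<le> exp 2 * (32 * ln (real T * \<kappa>) / \<kappa>)"
    unfolding sum_distrib_left[symmetric] by (intro mult_left_mono sum_log_exp_neg_le \<kappa> T) simp
  also have "\<dots> \<le> 9 * (32 * ln (real T * \<kappa>) / \<kappa>)"
  proof (rule mult_right_mono)
    have "exp (2::real) = exp 1 * exp 1" by (simp flip: exp_add)
    also have "\<dots> \<le> 3 * 3" using exp_le by (intro mult_mono) auto
    finally show "exp (2::real) \<le> 9" by simp
    have "1 \<le> exp (1::real)" by simp
    then have "1 \<le> real T * \<kappa>" using T by linarith
    then show "0 \<le> 32 * ln (real T * \<kappa>) / \<kappa>" using \<kappa> by simp
  qed
  finally show ?thesis by simp
qed

end

section \<open>Expected number of pulls\<close>

lemma emp_mean_upd_Inr [simp]: "emp_mean (\<omega> (Inr t := x)) a n = emp_mean \<omega> a n"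
  by (simp add: emp_mean_def part_sum_def)

lemma emp_max_upd_Inr [simp]: "s < t \<Longrightarrow> emp_max K (\<omega> (Inr t := x)) s = emp_max K \<omega> s"
  by (simp add: emp_max_def klms_state_upd_Inr)

lemma tilt_upd_Inr [simp]: "tilt c T (\<omega> (Inr t := x)) s = tilt c T \<omega> s"
  by (simp add: tilt_def)

text \<open>For count 0 the empirical mean and the level are both 0 by division by zero, and a
  nonnegative divergence is not below level 0. Sums over counts may therefore start at 1.\<close>

lemma tilt_0: "0 < c \<Longrightarrow> c < 1 \<Longrightarrow> tilt c T \<omega> 0 = 0"
  using klr_nonneg[of 0 c] by (simp add: tilt_def kl_level_def emp_mean_def)

text \<open>The 1 accounts for the forced pull of an arm in the first \<open>K\<close>
  rounds.\<close>

lemma pulls_le_Suc_sum: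
  "real (pulls K \<omega> T a) \<le> 1 + (\<Sum>t\<in>{K..<T}. if klms_arm K \<omega> (Suc t) = a then 1 else 0)"
proof (induction T)
  case (Suc T)
  show ?case
  proof (cases "T < K")
    case True
    then show ?thesis using pulls_forced[of "Suc T" K \<omega> a] by simp
  next
    case False
    then show ?thesis using Suc by (simp add: pulls_Suc)
  qed
qed simp

lemma sum_pulls:
  assumes "1 \<le> K"
  shows "(\<Sum>a=1..K. real (pulls K \<omega> T a)) = real T"
proof (induction T)
  case (Suc T)
  have "real (pulls K \<omega> (Suc T) a) = real (pulls K \<omega> T a) + (if a = klms_arm K \<omega> (Suc T) then 1 else 0)" for a
    by (auto simp: pulls_Suc)
  then show ?case
    using Suc klms_arm_range[OF assms, of \<omega> T] by (simp add: sum.distrib del: One_nat_def)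
qed simp

lemma sum_over_rounds_le:
  fixes f :: "nat \<Rightarrow> real"
  assumes "\<And>s. 0 \<le> f s"
  shows "(\<Sum>t\<in>{k..<T}. if klms_arm K \<omega> (Suc t) = a then f (pulls K \<omega> t a) else 0) \<le> (\<Sum>s<pulls K \<omega> T a. f s)"
proof -
  have "(\<Sum>t\<in>{k..<T}. if klms_arm K \<omega> (Suc t) = a then f (pulls K \<omega> t a) else 0)
      \<le> (\<Sum>t<T. if klms_arm K \<omega> (Suc t) = a then f (pulls K \<omega> t a) else 0)"
    using assms by (intro sum_mono2) auto
  then show ?thesis by (simp only: sum_over_pulls)
qed

context klms_bandit
begin

lemma integrable_bounded:
  fixes f :: "_ \<Rightarrow> real"
  assumes "f \<in> borel_measurable P" "\<And>\<omega>. 0 \<le> f \<omega>" "\<And>\<omega>. f \<omega> \<le> B"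
  shows "integrable P f"
  using assms by (intro integrable_const_bound[where B=B]) auto

lemma measurable_tilt_pulls [measurable]:
  "(\<lambda>\<omega>. tilt c T \<omega> (pulls K \<omega> t 1)) \<in> borel_measurable P"
  by (rule measurable_compose_countable[where f="\<lambda>n \<omega>. tilt c T \<omega> n"]) measurable

lemma measurable_kl_level_pulls [measurable]:
  "(\<lambda>\<omega>. kl_level T (pulls K \<omega> t a)) \<in> borel_measurable P"
  by (rule measurable_compose_countable[where f="\<lambda>n \<omega>. kl_level T n"]) measurable

lemma measurable_klr_emp_mean_pulls [measurable]:
  "(\<lambda>\<omega>. klr (emp_mean \<omega> a (pulls K \<omega> t a)) c) \<in> borel_measurable P"
  by (rule measurable_compose_countable[where f="\<lambda>n \<omega>. klr (emp_mean \<omega> a n) c"]) measurable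

text \<open>The normaliser is at least 1, so the probability of pulling \<open>a\<close> is at most
  its weight, which \<open>state_weight_le_exp\<close> bounds.\<close>

lemma expectation_pull_separated:
  assumes a: "a \<in> {1..K}" and t: "K \<le> t" and \<theta>: "0 < \<theta>" "\<theta> \<le> c" and \<kappa>: "\<kappa> \<le> klr \<theta> c" "0 \<le> \<kappa>"
  shows "(\<integral>\<omega>. (if klms_arm K \<omega> (Suc t) = a then
      (if u \<le> pulls K \<omega> t a \<and> emp_mean \<omega> a (pulls K \<omega> t a) < \<theta> \<and> c \<le> emp_max K \<omega> t then 1 else 0) else 0) \<partial>P)
    \<le> exp (- real u * \<kappa>)"
proof -
  define F :: "_ \<Rightarrow> real" where "F \<omega> = (if u \<le> pulls K \<omega> t a \<and> emp_mean \<omega> a (pulls K \<omega> t a) < \<theta> \<and> c \<le> emp_max K \<omega> t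
    then 1 else 0)" for \<omega>
  define p where "p \<omega> = state_weight K \<omega> t a / (\<Sum>b=1..K. state_weight K \<omega> t b)" for \<omega>
  have [measurable]: "F \<in> borel_measurable P" unfolding F_def by measurable
  have F: "0 \<le> F \<omega>" "F \<omega> \<le> 1" for \<omega> by (auto simp: F_def)
  have inv: "F (\<omega> (Inr (Suc t) := x)) = F \<omega>" for \<omega> x by (simp add: F_def klms_state_upd_Inr)
  have "(\<integral>\<omega>. (if klms_arm K \<omega> (Suc t) = a then F \<omega> else 0) \<partial>P) \<le> (\<integral>\<omega>. p \<omega> * F \<omega> \<partial>P)"
    unfolding p_def by (rule arm_prob_le[OF t a _ F inv]) measurable
  also have "\<dots> \<le> (\<integral>\<omega>. exp (- real u * \<kappa>) \<partial>P)"
  proof (rule integral_mono_AE')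
    show "AE \<omega> in P. p \<omega> * F \<omega> \<le> exp (- real u * \<kappa>)"
      using AE_rewards_unit
    proof eventually_elim
      case (elim \<omega>)
      have W: "1 \<le> (\<Sum>b=1..K. state_weight K \<omega> t b)" using state_weight_sum_ge_1 K2 by simp
      show ?case
      proof (cases "F \<omega> = 0")
        case False
        have cond: "u \<le> pulls K \<omega> t a \<and> emp_mean \<omega> a (pulls K \<omega> t a) < \<theta> \<and> c \<le> emp_max K \<omega> t"
        proof (rule ccontr)
          assume "\<not> ?thesis"
          then have "F \<omega> = 0" unfolding F_def by (simp only: if_False)
          with False show False by contradiction
        qed
        then have "state_weight K \<omega> t a \<le> exp (- real u * \<kappa>)"
          using elim by (intro state_weight_le_exp[OF a _ \<theta> _ _ _ \<kappa>]) auto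
        moreover have "p \<omega> \<le> state_weight K \<omega> t a"
          unfolding p_def using W state_weight_nonneg[of K \<omega> t a]
          by (simp add: pos_divide_le_eq mult_left_le_one_le mult_le_cancel_left1)
        moreover have "F \<omega> = 1" using cond by (simp add: F_def)
        ultimately show ?thesis by simp
      qed simp
    qed
  qed simp_all
  also have "\<dots> = exp (- real u * \<kappa>)" using prob_space by simp
  finally show ?thesis unfolding F_def .
qed

text \<open>Change of measure from arm \<open>a\<close> to arm \<open>1\<close>, at the price of the factor \<open>tilt\<close>.\<close>

lemma expectation_pull_underestimated:
  assumes a: "a \<in> {1..K}" and t: "K \<le> t" "t < T" and c: "0 < c" "c < 1"
  shows "(\<integral>\<omega>. (if klms_arm K \<omega> (Suc t) = a then
      (if emp_max K \<omega> t < c \<and> klr (emp_mean \<omega> 1 (pulls K \<omega> t 1)) c < kl_level T (pulls K \<omega> t 1) then 1 else 0) else 0) \<partial>P)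
    \<le> (\<integral>\<omega>. (if klms_arm K \<omega> (Suc t) = 1 then tilt c T \<omega> (pulls K \<omega> t 1) else 0) \<partial>P)"
proof -
  define F :: "_ \<Rightarrow> real" where "F \<omega> = (if emp_max K \<omega> t < c \<and> klr (emp_mean \<omega> 1 (pulls K \<omega> t 1)) c < kl_level T (pulls K \<omega> t 1)
    then 1 else 0)" for \<omega>
  define p where "p b \<omega> = state_weight K \<omega> t b / (\<Sum>b=1..K. state_weight K \<omega> t b)" for b \<omega>
  have [measurable]: "F \<in> borel_measurable P" unfolding F_def by measurable
  have [measurable]: "p b \<in> borel_measurable P" for b unfolding p_def by measurable
  have F: "0 \<le> F \<omega>" "F \<omega> \<le> 1" for \<omega> by (auto simp: F_def)
  have inv: "F (\<omega> (Inr (Suc t) := x)) = F \<omega>" for \<omega> x by (simp add: F_def klms_state_upd_Inr)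
  define G where "G \<omega> = tilt c T \<omega> (pulls K \<omega> t 1)" for \<omega>
  \<comment> \<open>A crude bound on \<open>tilt\<close> over all counts up to \<open>T\<close>, for
    integrability only.\<close>
  define B where "B = (\<Sum>s\<le>T. exp (real s * kl_level T s))"
  have [measurable]: "G \<in> borel_measurable P" unfolding G_def by measurable
  have G: "0 \<le> G \<omega>" "G \<omega> \<le> B" for \<omega>
  proof -
    show "0 \<le> G \<omega>" by (simp add: G_def tilt_bounds)
    let ?s = "pulls K \<omega> t 1"
    have "?s \<le> T" using pulls_le[of K \<omega> t 1] t by simp
    then have "exp (real ?s * kl_level T ?s) \<le> B"
      unfolding B_def by (intro member_le_sum[of ?s "{..T}" "\<lambda>s. exp (real s * kl_level T s)"]) auto
    then show "G \<omega> \<le> B" using tilt_bounds(2)[of c T \<omega> ?s] by (simp add: G_def)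
  qed
  have invG: "G (\<omega> (Inr (Suc t) := x)) = G \<omega>" for \<omega> x by (simp add: G_def klms_state_upd_Inr)
  have W: "1 \<le> (\<Sum>b=1..K. state_weight K \<omega> t b)" for \<omega> using state_weight_sum_ge_1 K2 by simp
  have p0: "0 \<le> p b \<omega>" for b \<omega>
    unfolding p_def by (intro divide_nonneg_nonneg sum_nonneg state_weight_nonneg)
  have p1: "p 1 \<omega> \<le> 1" for \<omega>
  proof -
    have "state_weight K \<omega> t 1 \<le> (\<Sum>b=1..K. state_weight K \<omega> t b)"
      using one_arm by (intro member_le_sum[of 1 "{1..K}"] state_weight_nonneg) auto
    then show ?thesis using W[of \<omega>] by (simp add: p_def divide_le_eq)
  qed
  have "(\<integral>\<omega>. (if klms_arm K \<omega> (Suc t) = a then F \<omega> else 0) \<partial>P) \<le> (\<integral>\<omega>. p a \<omega> * F \<omega> \<partial>P)"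
    unfolding p_def by (rule arm_prob_le[OF t(1) a _ F inv]) measurable
  also have "\<dots> \<le> (\<integral>\<omega>. p 1 \<omega> * G \<omega> \<partial>P)"
  proof (rule integral_mono_AE')
    show "integrable P (\<lambda>\<omega>. p 1 \<omega> * G \<omega>)"
    proof (rule integrable_bounded[where B="1 * B"])
      show "p 1 \<omega> * G \<omega> \<le> 1 * B" for \<omega> using p0 p1 G by (intro mult_mono) auto
      show "0 \<le> p 1 \<omega> * G \<omega>" for \<omega> by (intro mult_nonneg_nonneg p0 G)
    qed measurable
    show "AE \<omega> in P. p a \<omega> * F \<omega> \<le> p 1 \<omega> * G \<omega>"
      using AE_rewards_unit
    proof eventually_elim
      case (elim \<omega>)
      let ?s = "pulls K \<omega> t 1"
      let ?k = "klr (emp_mean \<omega> 1 ?s) c"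
      show ?case
      proof (cases "F \<omega> = 0")
        case True
        then show ?thesis using p0 G by (simp add: mult_nonneg_nonneg)
      next
        case False
        then have F1: "F \<omega> = 1" "emp_max K \<omega> t < c" "?k < kl_level T ?s" by (auto simp: F_def split: if_splits)
        have "emp_mean \<omega> 1 ?s < c" using emp_mean_le_emp_max[OF one_arm, of \<omega> t] F1 by simp
        then have G1: "G \<omega> = exp (real ?s * ?k)" using F1 by (simp add: G_def tilt_def)
        have "exp (- real ?s * ?k) \<le> state_weight K \<omega> t 1"
          using elim F1 c by (intro state_weight_ge_exp[OF one_arm]) auto
        then have "exp (- real ?s * ?k) * exp (real ?s * ?k) \<le> state_weight K \<omega> t 1 * G \<omega>"
          unfolding G1 by (rule mult_right_mono) simp
        then have "1 \<le> state_weight K \<omega> t 1 * G \<omega>" by (simp flip: exp_add)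
        moreover have "state_weight K \<omega> t a \<le> 1" using elim by (intro state_weight_le_1[OF a]) auto
        \<comment> \<open>The weight of \<open>a\<close> is at most 1, hence at most the weight of
          arm 1 times \<open>tilt\<close>. Dividing by the common normaliser compares the sampling
          probabilities.\<close>
        ultimately have "state_weight K \<omega> t a \<le> state_weight K \<omega> t 1 * G \<omega>" by simp
        then have "p a \<omega> \<le> state_weight K \<omega> t 1 * G \<omega> / (\<Sum>b=1..K. state_weight K \<omega> t b)"
          unfolding p_def using W[of \<omega>] by (intro divide_right_mono) auto
        then show ?thesis by (simp add: F1 p_def)
      qed
    qed
    show "AE \<omega> in P. 0 \<le> p 1 \<omega> * G \<omega>" using p0 G by (intro AE_I2 mult_nonneg_nonneg)
  qed
  also have "\<dots> \<le> (\<integral>\<omega>. (if klms_arm K \<omega> (Suc t) = 1 then G \<omega> else 0) \<partial>P)"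
    unfolding p_def by (rule arm_1_prob_ge[OF t(1) one_arm _ G invG refl]) measurable
  finally show ?thesis by (simp only: F_def G_def)
qed

text \<open>The slope of \<open>y * (1 - y)\<close> is at least -1 up to 1, so between
  \<open>\<mu> a\<close> and \<open>\<mu> 1\<close> the variance exceeds its value at
  \<open>\<mu> 1\<close> by at most the gap. This explains the denominator of
  \<open>\<kappa>\<close>.\<close>

lemma gap_variance:
  fixes x y z :: real
  assumes "z \<le> y" "y \<le> x" "0 \<le> z" "x \<le> 1"
  shows "y * (1 - y) \<le> x * (1 - x) + (x - z)"
proof -
  have "y * (1 - y) - x * (1 - x) = (x - y) * (x + y - 1)" by (simp add: algebra_simps)
  also have "\<dots> \<le> (x - y) * 1" using assms by (intro mult_left_mono) auto
  also have "\<dots> \<le> x - z" using assms by simp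
  finally show ?thesis by simp
qed

text \<open>The factor 32 is \<open>2 * 4 ^ 2\<close>: it comes from gaps
  \<open>\<Delta> / 4\<close> in \<open>klr_quadratic_lower\<close>. The four classes of pulls are
  \<open>A\<close>, \<open>B\<close>, \<open>C\<close>, \<open>D\<close>; on the event
  \<open>bad\<close> every round is counted.\<close>

lemma expectation_pulls_log:
  assumes a: "a \<in> {1..K}" and gap: "\<mu> a < \<mu> 1"
    and \<kappa>_def: "\<kappa> = (\<mu> 1 - \<mu> a)\<^sup>2 / (32 * (\<mu> 1 * (1 - \<mu> 1) + (\<mu> 1 - \<mu> a)))"
    and T: "exp 1 \<le> real T * \<kappa>"
  shows "(\<integral>\<omega>. real (pulls K \<omega> T a) \<partial>P) \<le> 3400 * ln (real T * \<kappa>) / \<kappa>"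
proof -
  define \<Delta> where "\<Delta> = \<mu> 1 - \<mu> a"
  define V where "V = \<mu> 1 * (1 - \<mu> 1) + \<Delta>"
  define \<theta> where "\<theta> = \<mu> a + \<Delta> / 4"
  define c where "c = \<mu> 1 - \<Delta> / 4"
  define L where "L = ln (real T * \<kappa>)"
  \<comment> \<open>A burn-in after which the sampling bound \<open>exp (- u * \<kappa>)\<close> is
    at most \<open>1 / (T * \<kappa>)\<close>.\<close>
  define u where "u = nat \<lceil>L / \<kappa>\<rceil>"
  have \<mu>: "0 \<le> \<mu> a" "0 \<le> \<mu> 1" "\<mu> 1 \<le> 1" using arm_mean_unit[OF a] arm_mean_unit[OF one_arm] by auto
  have \<Delta>: "0 < \<Delta>" "\<Delta> \<le> 1" "\<Delta> \<le> \<mu> 1" using gap \<mu> by (auto simp: \<Delta>_def)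
  have V: "\<Delta> \<le> V" using \<mu> by (simp add: V_def)
  have var: "y * (1 - y) \<le> V" if "\<mu> a \<le> y" "y \<le> \<mu> 1" for y
    unfolding V_def \<Delta>_def using that \<mu> by (intro gap_variance) auto
  have \<kappa>: "\<kappa> = \<Delta>\<^sup>2 / (32 * V)" by (simp add: \<kappa>_def \<Delta>_def V_def)
  have \<kappa>0: "0 < \<kappa>" using \<Delta> V by (simp add: \<kappa>)
  have "\<Delta>\<^sup>2 \<le> 1 * V" using \<Delta> V unfolding power2_eq_square by (intro mult_mono) auto
  then have \<kappa>1: "\<kappa> \<le> 1" using \<Delta> V by (simp add: \<kappa> divide_le_eq)
  have T\<kappa>: "0 < real T * \<kappa>" using T by (meson exp_gt_zero less_le_trans)
  then have T0: "0 < real T" using \<kappa>0 by (simp add: zero_less_mult_iff)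
  have L1: "1 \<le> L" unfolding L_def using T T\<kappa> by (subst ln_ge_iff) auto
  have \<theta>c: "0 < \<theta>" "\<mu> a < \<theta>" "\<theta> < 1" "\<theta> \<le> c" "0 < c" "c < \<mu> 1" "c < 1" "\<theta> \<le> \<mu> 1"
    using \<Delta> \<mu> by (auto simp: \<theta>_def c_def \<Delta>_def field_simps)
  have up: "\<kappa> \<le> klr \<theta> (\<mu> a)" if "0 < \<mu> a"
  proof -
    \<comment> \<open>Upward deviations become downward ones by exchanging the outcomes 0 and
      1.\<close>
    have "((1 - \<mu> a) - (1 - \<theta>))\<^sup>2 / (2 * V) \<le> klr (1 - \<theta>) (1 - \<mu> a)"
    proof (rule klr_quadratic_lower)
      fix x assume "1 - \<theta> \<le> x" "x \<le> 1 - \<mu> a"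
      then show "x * (1 - x) \<le> V" using var[of "1 - x"] \<theta>c by (simp add: mult.commute)
    qed (use \<theta>c that in auto)
    then show ?thesis by (simp add: klr_flip \<kappa> \<theta>_def power_divide)
  qed
  have low: "\<kappa> \<le> klr c (\<mu> 1)" if "\<mu> 1 < 1"
  proof -
    have "(\<mu> 1 - c)\<^sup>2 / (2 * V) \<le> klr c (\<mu> 1)"
      using \<theta>c var that by (intro klr_quadratic_lower) auto
    then show ?thesis by (simp add: \<kappa> c_def power_divide)
  qed
  have mid: "\<kappa> \<le> klr \<theta> c"
  proof -
    have "(c - \<theta>)\<^sup>2 / (2 * V) \<le> klr \<theta> c"
      using \<theta>c var by (intro klr_quadratic_lower) auto
    moreover have "c - \<theta> = \<Delta> / 2" by (simp add: c_def \<theta>_def \<Delta>_def field_simps)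
    moreover have "\<Delta>\<^sup>2 / (32 * V) \<le> (\<Delta> / 2)\<^sup>2 / (2 * V)"
      using \<Delta> V by (simp add: power_divide divide_simps)
    ultimately show ?thesis by (simp add: \<kappa>)
  qed
  define bad where "bad = {\<omega>. \<exists>s\<in>{1..T}. emp_mean \<omega> 1 s < c \<and> kl_level T s \<le> klr (emp_mean \<omega> 1 s) c}"
  have bad_m [measurable]: "bad \<in> events" unfolding bad_def by (rule events_Collect) measurable
  define A where "A s = (if s < u then 1 else 0 :: real)" for s
  define B where "B \<omega> s = (if \<theta> \<le> emp_mean \<omega> a s \<and> 1 \<le> s then 1 else 0 :: real)" for \<omega> s
  define C where "C t \<omega> = (if u \<le> pulls K \<omega> t a \<and> emp_mean \<omega> a (pulls K \<omega> t a) < \<theta> \<and> c \<le> emp_max K \<omega> t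
    then 1 else 0 :: real)" for t \<omega>
  define D where "D t \<omega> = (if emp_max K \<omega> t < c \<and> klr (emp_mean \<omega> 1 (pulls K \<omega> t 1)) c < kl_level T (pulls K \<omega> t 1)
    then 1 else 0 :: real)" for t \<omega>
  let ?on = "\<lambda>t \<omega> (x :: real). if klms_arm K \<omega> (Suc t) = a then x else 0"
  define RA where "RA \<omega> = (\<Sum>t\<in>{K..<T}. ?on t \<omega> (A (pulls K \<omega> t a)))" for \<omega>
  define RB where "RB \<omega> = (\<Sum>t\<in>{K..<T}. ?on t \<omega> (B \<omega> (pulls K \<omega> t a)))" for \<omega>
  define RC where "RC \<omega> = (\<Sum>t\<in>{K..<T}. ?on t \<omega> (C t \<omega>))" for \<omega>
  define RD where "RD \<omega> = (\<Sum>t\<in>{K..<T}. ?on t \<omega> (D t \<omega>))" for \<omega>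
  have [measurable]: "(\<lambda>\<omega>. A (pulls K \<omega> t a)) \<in> borel_measurable P" for t
    unfolding A_def by measurable
  have [measurable]: "(\<lambda>\<omega>. B \<omega> s) \<in> borel_measurable P" for s
    unfolding B_def by measurable
  have [measurable]: "(\<lambda>\<omega>. B \<omega> (pulls K \<omega> t a)) \<in> borel_measurable P" for t
    unfolding B_def by measurable
  have [measurable]: "C t \<in> borel_measurable P" "D t \<in> borel_measurable P" for t
    unfolding C_def D_def by measurable
  have on_int: "integrable P (\<lambda>\<omega>. ?on t \<omega> (f \<omega>))"
    if "f \<in> borel_measurable P" "\<And>\<omega>. f \<omega> \<in> {0, 1}" for t f
  proof (rule integrable_bounded[where B=1])
    show "(\<lambda>\<omega>. ?on t \<omega> (f \<omega>)) \<in> borel_measurable P" using that(1) by measurable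
    show "0 \<le> ?on t \<omega> (f \<omega>)" "?on t \<omega> (f \<omega>) \<le> 1" for \<omega> using that(2)[of \<omega>] by auto
  qed
  have intA: "integrable P (\<lambda>\<omega>. ?on t \<omega> (A (pulls K \<omega> t a)))" for t by (rule on_int) (auto simp: A_def)
  have intB: "integrable P (\<lambda>\<omega>. ?on t \<omega> (B \<omega> (pulls K \<omega> t a)))" for t by (rule on_int, measurable) (auto simp: B_def)
  have intC: "integrable P (\<lambda>\<omega>. ?on t \<omega> (C t \<omega>))" for t by (rule on_int, measurable) (auto simp: C_def)
  have intD: "integrable P (\<lambda>\<omega>. ?on t \<omega> (D t \<omega>))" for t by (rule on_int, measurable) (auto simp: D_def)
  have intR: "integrable P RA" "integrable P RB" "integrable P RC" "integrable P RD"
    unfolding RA_def RB_def RC_def RD_def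
    by (intro Bochner_Integration.integrable_sum intA intB intC intD)+
  have pointwise: "real (pulls K \<omega> T a) \<le> 1 + RA \<omega> + RB \<omega> + RC \<omega> + RD \<omega> + real T * indicator bad \<omega>" for \<omega>
  proof -
    have "?on t \<omega> 1 \<le> ?on t \<omega> (A (pulls K \<omega> t a)) + ?on t \<omega> (B \<omega> (pulls K \<omega> t a))
        + ?on t \<omega> (C t \<omega>) + ?on t \<omega> (D t \<omega>) + indicator bad \<omega>" if t: "t \<in> {K..<T}" for t
    proof -
      have N: "1 \<le> pulls K \<omega> t a" "1 \<le> pulls K \<omega> t 1" "pulls K \<omega> t 1 \<le> T"
        using pulls_pos[of K t a \<omega>] pulls_pos[of K t 1 \<omega>] pulls_le[of K \<omega> t 1] t a one_arm by auto
      have "emp_mean \<omega> 1 (pulls K \<omega> t 1) \<le> emp_max K \<omega> t" by (rule emp_mean_le_emp_max[OF one_arm])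
      \<comment> \<open>The mean of arm 1 is below \<open>c\<close> with the maximum. As its count
        lies in \<open>{1..T}\<close>, being off \<open>bad\<close> keeps its divergence below the
        level.\<close>
      then have "D t \<omega> = 1" if "emp_max K \<omega> t < c" "\<omega> \<notin> bad"
        using that N by (force simp: D_def bad_def)
      then show ?thesis using N by (auto simp: A_def B_def C_def D_def indicator_def)
    qed
    then have "(\<Sum>t\<in>{K..<T}. ?on t \<omega> 1) \<le> (\<Sum>t\<in>{K..<T}. ?on t \<omega> (A (pulls K \<omega> t a)) + ?on t \<omega> (B \<omega> (pulls K \<omega> t a))
        + ?on t \<omega> (C t \<omega>) + ?on t \<omega> (D t \<omega>) + indicator bad \<omega>)" by (rule sum_mono)
    also have "\<dots> = RA \<omega> + RB \<omega> + RC \<omega> + RD \<omega> + real (T - K) * indicator bad \<omega>"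
      by (simp only: sum.distrib RA_def RB_def RC_def RD_def sum_constant card_atLeastLessThan)
    also have "real (T - K) * indicator bad \<omega> \<le> real T * indicator bad \<omega>"
      by (intro mult_right_mono) auto
    finally show ?thesis using pulls_le_Suc_sum[of K \<omega> T a] by simp
  qed
  have int_bad: "integrable P (\<lambda>\<omega>. real T * indicator bad \<omega>)"
    by (intro integrable_mult_right integrable_real_indicator) (simp_all add: emeasure_eq_measure)
  have "(\<integral>\<omega>. real (pulls K \<omega> T a) \<partial>P)
      \<le> (\<integral>\<omega>. 1 + RA \<omega> + RB \<omega> + RC \<omega> + RD \<omega> + real T * indicator bad \<omega> \<partial>P)"
  proof (rule integral_mono)
    show "integrable P (\<lambda>\<omega>. real (pulls K \<omega> T a))"
      using pulls_le[of K _ T a] by (intro integrable_bounded[where B="real T"]) auto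
    show "integrable P (\<lambda>\<omega>. 1 + RA \<omega> + RB \<omega> + RC \<omega> + RD \<omega> + real T * indicator bad \<omega>)"
      by (intro Bochner_Integration.integrable_add intR int_bad) simp
  qed (rule pointwise)
  also have "\<dots> = 1 + (\<integral>\<omega>. RA \<omega> \<partial>P) + (\<integral>\<omega>. RB \<omega> \<partial>P) + (\<integral>\<omega>. RC \<omega> \<partial>P) + (\<integral>\<omega>. RD \<omega> \<partial>P) + real T * prob bad"
    using intR int_bad prob_space by simp
  finally have main: "(\<integral>\<omega>. real (pulls K \<omega> T a) \<partial>P)
    \<le> 1 + (\<integral>\<omega>. RA \<omega> \<partial>P) + (\<integral>\<omega>. RB \<omega> \<partial>P) + (\<integral>\<omega>. RC \<omega> \<partial>P) + (\<integral>\<omega>. RD \<omega> \<partial>P) + real T * prob bad" .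
  have A_le: "(\<integral>\<omega>. RA \<omega> \<partial>P) \<le> L / \<kappa> + 1"
  proof -
    have "RA \<omega> \<le> real u" for \<omega>
    proof -
      have "RA \<omega> \<le> (\<Sum>s<pulls K \<omega> T a. A s)"
        unfolding RA_def by (rule sum_over_rounds_le) (simp add: A_def)
      also have "\<dots> = (\<Sum>s\<in>{s\<in>{..<pulls K \<omega> T a}. s < u}. 1)"
        unfolding A_def by (rule sum.inter_filter[symmetric]) simp
      also have "\<dots> \<le> (\<Sum>s<u. 1)" by (rule sum_mono2) auto
      finally show ?thesis by simp
    qed
    then have "(\<integral>\<omega>. RA \<omega> \<partial>P) \<le> (\<integral>\<omega>. real u \<partial>P)" by (intro integral_mono intR) auto
    also have "\<dots> = real u" using prob_space by simp
    also have "\<dots> \<le> L / \<kappa> + 1" using L1 \<kappa>0 unfolding u_def by simp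
    finally show ?thesis .
  qed
  have B_le: "(\<integral>\<omega>. RB \<omega> \<partial>P) \<le> 1 / \<kappa>"
  proof -
    have intBs: "integrable P (\<lambda>\<omega>. B \<omega> s)" for s
      by (rule integrable_bounded[where B=1]) (measurable, auto simp: B_def)
    have "RB \<omega> \<le> (\<Sum>s=1..T. B \<omega> s)" for \<omega>
    proof -
      have "RB \<omega> \<le> (\<Sum>s<pulls K \<omega> T a. B \<omega> s)"
        unfolding RB_def by (rule sum_over_rounds_le) (simp add: B_def)
      also have "\<dots> \<le> (\<Sum>s\<le>T. B \<omega> s)"
        using pulls_le[of K \<omega> T a] by (intro sum_mono2) (auto simp: B_def)
      also have "\<dots> = (\<Sum>s=1..T. B \<omega> s)"
        by (rule sum.mono_neutral_right) (auto simp: B_def)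
      finally show ?thesis .
    qed
    then have "(\<integral>\<omega>. RB \<omega> \<partial>P) \<le> (\<integral>\<omega>. (\<Sum>s=1..T. B \<omega> s) \<partial>P)"
      by (intro integral_mono intR Bochner_Integration.integrable_sum intBs)
    also have "\<dots> = (\<Sum>s=1..T. \<integral>\<omega>. B \<omega> s \<partial>P)" by (rule Bochner_Integration.integral_sum[OF intBs])
    also have "\<dots> \<le> (\<Sum>s=1..T. exp (- real s * \<kappa>))"
    proof (rule sum_mono)
      fix s assume s: "s \<in> {1..T}"
      have "(\<integral>\<omega>. B \<omega> s \<partial>P) = (\<integral>\<omega>. indicator {\<omega>. \<theta> \<le> emp_mean \<omega> a s} \<omega> \<partial>P)"
        using s by (intro Bochner_Integration.integral_cong) (auto simp: B_def indicator_def)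
      also have "\<dots> = prob {\<omega>. \<theta> \<le> emp_mean \<omega> a s}" by simp
      also have "\<dots> \<le> exp (- real s * \<kappa>)"
        using s by (intro prob_emp_mean_ge[OF a \<theta>c(2,3)] up) auto
      finally show "(\<integral>\<omega>. B \<omega> s \<partial>P) \<le> exp (- real s * \<kappa>)" .
    qed
    also have "\<dots> \<le> 1 / \<kappa>" by (rule sum_exp_neg_le[OF \<kappa>0])
    finally show ?thesis .
  qed
  have C_le: "(\<integral>\<omega>. RC \<omega> \<partial>P) \<le> 1 / \<kappa>"
  proof -
    have "(\<integral>\<omega>. RC \<omega> \<partial>P) = (\<Sum>t\<in>{K..<T}. \<integral>\<omega>. ?on t \<omega> (C t \<omega>) \<partial>P)"
      unfolding RC_def by (rule Bochner_Integration.integral_sum[OF intC])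
    also have "\<dots> \<le> (\<Sum>t\<in>{K..<T}. exp (- real u * \<kappa>))"
    proof (rule sum_mono)
      fix t assume "t \<in> {K..<T}"
      then show "(\<integral>\<omega>. ?on t \<omega> (C t \<omega>) \<partial>P) \<le> exp (- real u * \<kappa>)"
        unfolding C_def using \<theta>c \<kappa>0 mid by (intro expectation_pull_separated[OF a]) auto
    qed
    also have "\<dots> \<le> real T * exp (- real u * \<kappa>)" by (simp add: mult_right_mono)
    also have "\<dots> \<le> real T * exp (- L)"
    proof -
      have "L / \<kappa> \<le> real u" unfolding u_def by (rule of_nat_ceiling)
      then have "L \<le> real u * \<kappa>" using \<kappa>0 by (simp add: pos_divide_le_eq)
      then show ?thesis by (intro mult_left_mono) auto
    qed
    also have "\<dots> = 1 / \<kappa>" unfolding L_def using T\<kappa> T0 by (simp add: exp_minus field_simps)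
    finally show ?thesis .
  qed
  have D_le: "(\<integral>\<omega>. RD \<omega> \<partial>P) \<le> 288 * L / \<kappa>"
  proof -
    have tint: "integrable P (\<lambda>\<omega>. tilt c T \<omega> s)" for s
      using tilt_bounds by (intro integrable_bounded) auto
    define M where "M = (\<Sum>s\<le>T. exp (real s * kl_level T s))"
    have tM: "tilt c T \<omega> s \<le> M" if "s \<le> T" for \<omega> s
    proof -
      have "exp (real s * kl_level T s) \<le> M"
        unfolding M_def using that by (intro member_le_sum[of s "{..T}" "\<lambda>s. exp (real s * kl_level T s)"]) auto
      then show ?thesis using tilt_bounds(2)[of c T \<omega> s] by simp
    qed
    have M0: "0 \<le> M" unfolding M_def by (intro sum_nonneg) simp
    let ?on1 = "\<lambda>t \<omega>. if klms_arm K \<omega> (Suc t) = 1 then tilt c T \<omega> (pulls K \<omega> t 1) else 0"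
    have on1_int: "integrable P (?on1 t)" if "t \<in> {K..<T}" for t
    proof (rule integrable_bounded[where B=M])
      show "?on1 t \<omega> \<le> M" for \<omega> using tM[of "pulls K \<omega> t 1" \<omega>] pulls_le[of K \<omega> t 1] that M0 by auto
      show "0 \<le> ?on1 t \<omega>" for \<omega> using tilt_bounds by auto
    qed measurable
    have "(\<integral>\<omega>. RD \<omega> \<partial>P) = (\<Sum>t\<in>{K..<T}. \<integral>\<omega>. ?on t \<omega> (D t \<omega>) \<partial>P)"
      unfolding RD_def by (rule Bochner_Integration.integral_sum[OF intD])
    also have "\<dots> \<le> (\<Sum>t\<in>{K..<T}. \<integral>\<omega>. ?on1 t \<omega> \<partial>P)"
    proof (rule sum_mono)
      fix t assume "t \<in> {K..<T}"
      then show "(\<integral>\<omega>. ?on t \<omega> (D t \<omega>) \<partial>P) \<le> (\<integral>\<omega>. ?on1 t \<omega> \<partial>P)"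
        unfolding D_def using \<theta>c by (intro expectation_pull_underestimated[OF a]) auto
    qed
    also have "\<dots> = (\<integral>\<omega>. (\<Sum>t\<in>{K..<T}. ?on1 t \<omega>) \<partial>P)"
      by (rule Bochner_Integration.integral_sum[symmetric, OF on1_int])
    \<comment> \<open>Distinct pulls of arm 1 occur at distinct counts, so the charges are summed
      over counts.\<close>
    also have "\<dots> \<le> (\<integral>\<omega>. (\<Sum>s=1..T. tilt c T \<omega> s) \<partial>P)"
    proof (intro integral_mono Bochner_Integration.integrable_sum on1_int tint)
      fix \<omega>
      have "(\<Sum>t\<in>{K..<T}. ?on1 t \<omega>) \<le> (\<Sum>s<pulls K \<omega> T 1. tilt c T \<omega> s)"
        by (rule sum_over_rounds_le) (rule tilt_bounds)
      also have "\<dots> \<le> (\<Sum>s\<le>T. tilt c T \<omega> s)"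
        using pulls_le[of K \<omega> T 1] by (intro sum_mono2) (auto simp: tilt_bounds)
      also have "\<dots> = (\<Sum>s=1..T. tilt c T \<omega> s)"
      proof (rule sum.mono_neutral_right)
        show "\<forall>s\<in>{..T} - {1..T}. tilt c T \<omega> s = 0"
          using tilt_0[OF \<theta>c(5,7)] by (auto simp: not_less_eq_eq)
      qed auto
      finally show "(\<Sum>t\<in>{K..<T}. ?on1 t \<omega>) \<le> (\<Sum>s=1..T. tilt c T \<omega> s)" .
    qed
    also have "\<dots> = (\<Sum>s=1..T. \<integral>\<omega>. tilt c T \<omega> s \<partial>P)" by (rule Bochner_Integration.integral_sum[OF tint])
    also have "\<dots> \<le> 288 * ln (real T * \<kappa>) / \<kappa>"
      by (rule sum_expectation_tilt_le[OF \<theta>c(5,6) low \<kappa>0 T])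
    finally show ?thesis by (simp add: L_def)
  qed
  have bad_le: "real T * prob bad \<le> 3072 / \<kappa>"
    unfolding bad_def by (rule prob_kl_level_exceeded[OF \<theta>c(5,6) low \<kappa>0 T])
  \<comment> \<open>Every term is now a multiple of \<open>L / \<kappa>\<close>; the coefficients
    add up to 5 + 288 + 3072 = 3365.\<close>
  have "1 \<le> 1 / \<kappa>" using \<kappa>0 \<kappa>1 by simp
  moreover have "1 / \<kappa> \<le> L / \<kappa>" using \<kappa>0 L1 by (intro divide_right_mono) auto
  ultimately have "(\<integral>\<omega>. real (pulls K \<omega> T a) \<partial>P) \<le> 3400 * (L / \<kappa>)"
    using main A_le B_le C_le D_le bad_le by simp
  then show ?thesis by (simp add: L_def)
qed

text \<open>When \<open>T * \<kappa> < exp 1\<close>, the trivial bound \<open>T\<close> on the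
  count is already at most \<open>3 / \<kappa>\<close>.\<close>

lemma expectation_pulls:
  assumes a: "a \<in> {1..K}" and gap: "\<mu> a < \<mu> 1"
    and \<kappa>_def: "\<kappa> = (\<mu> 1 - \<mu> a)\<^sup>2 / (32 * (\<mu> 1 * (1 - \<mu> 1) + (\<mu> 1 - \<mu> a)))"
  shows "(\<integral>\<omega>. real (pulls K \<omega> T a) \<partial>P) \<le> 3400 * max 1 (ln (real T * \<kappa>)) / \<kappa>"
proof -
  have "0 < \<mu> 1 * (1 - \<mu> 1) + (\<mu> 1 - \<mu> a)"
    using arm_mean_unit[OF one_arm] gap by (intro add_nonneg_pos mult_nonneg_nonneg) auto
  then have \<kappa>0: "0 < \<kappa>" using gap by (simp add: \<kappa>_def)
  show ?thesis
  proof (cases "exp 1 \<le> real T * \<kappa>")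
    case True
    have "3400 * ln (real T * \<kappa>) / \<kappa> \<le> 3400 * max 1 (ln (real T * \<kappa>)) / \<kappa>"
      using \<kappa>0 by (intro divide_right_mono) auto
    then show ?thesis using expectation_pulls_log[OF a gap \<kappa>_def True] by linarith
  next
    case False
    have "(\<integral>\<omega>. real (pulls K \<omega> T a) \<partial>P) \<le> (\<integral>\<omega>. real T \<partial>P)"
      using pulls_le[of K _ T a] by (intro integral_mono integrable_bounded[where B="real T"]) auto
    also have "\<dots> = real T" using prob_space by simp
    also have "\<dots> \<le> 3 / \<kappa>" using False \<kappa>0 exp_le by (simp add: pos_le_divide_eq)
    also have "\<dots> \<le> 3400 * max 1 (ln (real T * \<kappa>)) / \<kappa>"
      using \<kappa>0 by (intro divide_right_mono) auto
    finally show ?thesis .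
  qed
qed

section \<open>Regret decomposition\<close>

lemma expectation_reward:
  "integrable P (\<lambda>\<omega>. klms_reward K \<omega> (Suc t)) \<and>
   (\<integral>\<omega>. klms_reward K \<omega> (Suc t) \<partial>P)
     = (\<Sum>a=1..K. \<mu> a * (\<integral>\<omega>. (if klms_arm K \<omega> (Suc t) = a then 1 else 0) \<partial>P))"
proof -
  \<comment> \<open>\<open>I a n\<close> marks round \<open>t + 1\<close> as the pull of
    \<open>a\<close> with reward index \<open>n\<close>. It does not depend on that reward, so
    resampling replaces the reward by its mean.\<close>
  define I where "I a n \<omega> = (if klms_arm K \<omega> (Suc t) = a \<and> pulls K \<omega> t a = n then 1 else 0 :: real)" for a n \<omega>
  have [measurable]: "I a n \<in> borel_measurable P" for a n unfolding I_def by measurable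
  have I01: "0 \<le> I a n \<omega>" "I a n \<omega> \<le> 1" for a n \<omega> by (auto simp: I_def)
  have I_int: "integrable P (I a n)" for a n
    by (rule integrable_bounded[where B=1]) (measurable, auto simp: I_def)
  have reward: "klms_reward K \<omega> (Suc t) = (\<Sum>a=1..K. \<Sum>n\<le>t. I a n \<omega> * \<omega> (Inl (a, n)))" for \<omega>
  proof -
    let ?b = "klms_arm K \<omega> (Suc t)"
    have "(\<Sum>n\<le>t. I a n \<omega> * \<omega> (Inl (a, n))) = (if a = ?b then \<omega> (Inl (a, pulls K \<omega> t a)) else 0)" for a
    proof (cases "a = ?b")
      case True
      have "(\<Sum>n\<le>t. I a n \<omega> * \<omega> (Inl (a, n))) = (\<Sum>n\<le>t. if n = pulls K \<omega> t a then \<omega> (Inl (a, n)) else 0)"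
        using True by (intro sum.cong) (auto simp: I_def)
      then show ?thesis using True pulls_le[of K \<omega> t a] by simp
    next
      case False
      then have "I a n \<omega> = 0" for n by (auto simp: I_def)
      then show ?thesis using False by simp
    qed
    then show ?thesis
      using klms_arm_range[of K \<omega> t] K2 by (simp add: klms_reward_Suc)
  qed
  have summand: "integrable P (\<lambda>\<omega>. I a n \<omega> * \<omega> (Inl (a, n))) \<and>
      (\<integral>\<omega>. I a n \<omega> * \<omega> (Inl (a, n)) \<partial>P) = \<mu> a * (\<integral>\<omega>. I a n \<omega> \<partial>P)" if a: "a \<in> {1..K}" for a n
  proof -
    have int: "integrable P (\<lambda>\<omega>. I a n \<omega> * \<omega> (Inl (a, n)))"
    proof (rule integrable_const_bound[where B=1])
      show "AE \<omega> in P. norm (I a n \<omega> * \<omega> (Inl (a, n))) \<le> 1"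
        using AE_rewards_unit
      proof eventually_elim
        case (elim \<omega>)
        then have "\<omega> (Inl (a, n)) \<in> {0..1}" using a by blast
        then show ?case by (auto simp: I_def)
      qed
    qed measurable
    have inv: "I a n (\<omega> (Inl (a, n) := x)) = I a n \<omega>" for \<omega> x
      unfolding I_def by (simp only: klms_pull_event_upd_Inl)
    have "(\<integral>x. I a n (\<omega> (Inl (a, n) := x)) * (\<omega> (Inl (a, n) := x)) (Inl (a, n)) \<partial>coord (Inl (a, n)))
        = \<mu> a * I a n \<omega>" for \<omega>
      unfolding inv coord_Inl[OF a] fun_upd_same by (simp add: arm_mean_def)
    then have "(\<integral>\<omega>. I a n \<omega> * \<omega> (Inl (a, n)) \<partial>P) = (\<integral>\<omega>. \<mu> a * I a n \<omega> \<partial>P)"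
      by (subst integral_resample[OF int, where i="Inl (a, n)"]) (simp only:)
    then show ?thesis using int by simp
  qed
  have sumI: "(\<Sum>n\<le>t. \<integral>\<omega>. I a n \<omega> \<partial>P) = (\<integral>\<omega>. (if klms_arm K \<omega> (Suc t) = a then 1 else 0) \<partial>P)" for a
  proof -
    have "(\<Sum>n\<le>t. I a n \<omega>) = (if klms_arm K \<omega> (Suc t) = a then 1 else 0)" for \<omega>
      using pulls_le[of K \<omega> t a] by (simp add: I_def)
    then show ?thesis by (simp add: I_int flip: Bochner_Integration.integral_sum)
  qed
  have "(\<integral>\<omega>. klms_reward K \<omega> (Suc t) \<partial>P) = (\<Sum>a=1..K. \<Sum>n\<le>t. \<integral>\<omega>. I a n \<omega> * \<omega> (Inl (a, n)) \<partial>P)"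
    unfolding reward using summand
    by (subst Bochner_Integration.integral_sum; (intro sum.cong refl)?)
      (auto intro!: Bochner_Integration.integrable_sum Bochner_Integration.integral_sum)
  also have "\<dots> = (\<Sum>a=1..K. \<mu> a * (\<Sum>n\<le>t. \<integral>\<omega>. I a n \<omega> \<partial>P))"
    using summand by (intro sum.cong) (simp_all add: sum_distrib_left)
  finally have "(\<integral>\<omega>. klms_reward K \<omega> (Suc t) \<partial>P) = (\<Sum>a=1..K. \<mu> a * (\<Sum>n\<le>t. \<integral>\<omega>. I a n \<omega> \<partial>P))" .
  moreover have "integrable P (\<lambda>\<omega>. klms_reward K \<omega> (Suc t))"
    unfolding reward using summand by (intro Bochner_Integration.integrable_sum) blast
  ultimately show ?thesis by (simp only: sumI)
qed

lemma klms_regret_eq: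
  "klms_regret K nu T = (\<Sum>a=1..K. (\<mu> 1 - \<mu> a) * (\<integral>\<omega>. real (pulls K \<omega> T a) \<partial>P))"
proof -
  let ?q = "\<lambda>t a. \<integral>\<omega>. (if klms_arm K \<omega> (Suc t) = a then 1 else 0 :: real) \<partial>P"
  have q_int: "integrable P (\<lambda>\<omega>. if klms_arm K \<omega> (Suc t) = a then 1 else 0 :: real)" for t a
    by (rule integrable_bounded[where B=1]) auto
  have EN: "(\<integral>\<omega>. real (pulls K \<omega> T a) \<partial>P) = (\<Sum>t<T. ?q t a)" for a
  proof -
    have "real (pulls K \<omega> T a) = (\<Sum>t<T. if klms_arm K \<omega> (Suc t) = a then 1 else 0)" for \<omega>
      using sum_over_pulls[of K \<omega> a "\<lambda>_. 1" T] by simp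
    then show ?thesis by (simp add: q_int)
  qed
  have N_int: "integrable P (\<lambda>\<omega>. real (pulls K \<omega> T a))" for a
    using pulls_le[of K _ T a] by (intro integrable_bounded[where B="real T"]) auto
  have "(\<Sum>t=1..T. klms_reward K \<omega> t) = (\<Sum>t<T. klms_reward K \<omega> (Suc t))" for \<omega>
    by (rule sum.reindex_bij_witness[of _ Suc "\<lambda>t. t - 1"]) auto
  then have "(\<integral>\<omega>. (\<Sum>t=1..T. klms_reward K \<omega> t) \<partial>P) = (\<Sum>t<T. \<Sum>a=1..K. \<mu> a * ?q t a)"
    using expectation_reward by (simp del: One_nat_def)
  also have "\<dots> = (\<Sum>a=1..K. \<mu> a * (\<integral>\<omega>. real (pulls K \<omega> T a) \<partial>P))"
    unfolding EN sum_distrib_left by (rule sum.swap)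
  finally have R: "klms_regret K nu T = real T * \<mu> 1 - (\<Sum>a=1..K. \<mu> a * (\<integral>\<omega>. real (pulls K \<omega> T a) \<partial>P))"
    by (simp only: klms_regret_def)
  have "(\<Sum>a=1..K. \<integral>\<omega>. real (pulls K \<omega> T a) \<partial>P) = (\<integral>\<omega>. (\<Sum>a=1..K. real (pulls K \<omega> T a)) \<partial>P)"
    by (rule Bochner_Integration.integral_sum[symmetric, OF N_int])
  also have "\<dots> = (\<integral>\<omega>. real T \<partial>P)" using sum_pulls[of K] K2 by simp
  also have "\<dots> = real T" using prob_space by simp
  finally have "real T * \<mu> 1 = (\<Sum>a=1..K. \<mu> 1 * (\<integral>\<omega>. real (pulls K \<omega> T a) \<partial>P))"
    by (simp add: mult.commute flip: sum_distrib_left)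
  then show ?thesis unfolding R by (simp add: left_diff_distrib sum_subtractf)
qed

end

section \<open>Worst-case regret\<close>

lemma half_le_ln:
  assumes "2 \<le> x"
  shows "1 / 2 \<le> ln (x :: real)"
proof -
  have "1 - 1 / 2 \<le> ln (2 :: real)" using ln_le_minus_one[of "1 / 2 :: real"] by (simp add: ln_div)
  also have "\<dots> \<le> ln x" using assms by simp
  finally show ?thesis by simp
qed

text \<open>For \<open>w = z / k\<close> the hypothesis says \<open>w \<ge> ln k\<close>, so both
  \<open>ln k\<close> and \<open>ln w \<le> 2 * sqrt w\<close> are bounded by multiples of
  \<open>sqrt (w * ln k)\<close>. Above the gap threshold this trades the logarithm in
  \<open>T\<close> for \<open>sqrt (ln K)\<close>.\<close>

lemma max_1_ln_le_sqrt:
  fixes k z :: real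
  assumes k: "2 \<le> k" and z: "k * ln k \<le> z"
  shows "max 1 (ln z) \<le> 5 * sqrt (z * ln k / k)"
proof -
  define w where "w = z / k"
  define r where "r = sqrt (w * ln k)"
  have lnk: "1 / 2 \<le> ln k" by (rule half_le_ln[OF k])
  have w: "ln k \<le> w" using k z by (simp add: w_def pos_le_divide_eq mult.commute)
  have zw: "z = w * k" using k by (simp add: w_def)
  have "ln k = sqrt (ln k * ln k)" using lnk by simp
  also have "\<dots> \<le> r" unfolding r_def using w lnk by (intro real_sqrt_le_mono mult_right_mono) auto
  finally have r: "ln k \<le> r" .
  have "ln w \<le> 2 * sqrt w" using w lnk by (intro ln_le_2_sqrt) auto
  also have "sqrt w \<le> sqrt (4 * (w * ln k))"
  proof (rule real_sqrt_le_mono)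
    have "w * 1 \<le> w * (4 * ln k)" using w lnk by (intro mult_left_mono) auto
    then show "w \<le> 4 * (w * ln k)" by simp
  qed
  also have "\<dots> = 2 * r" by (simp add: r_def real_sqrt_mult)
  finally have "ln w \<le> 4 * r" by simp
  moreover have "ln z = ln w + ln k" using w lnk k by (simp add: zw ln_mult)
  ultimately have "max 1 (ln z) \<le> 5 * r" using r lnk by simp
  then show ?thesis by (simp add: r_def w_def)
qed

context klms_bandit
begin

lemma arm_regret_le:
  assumes a: "a \<in> {1..K}" and T: "2 \<le> T"
  defines "v \<equiv> \<mu> 1 * (1 - \<mu> 1)"
  shows "(\<mu> 1 - \<mu> a) * (\<integral>\<omega>. real (pulls K \<omega> T a) \<partial>P)
    \<le> sqrt (v * real K * ln (real K) / real T) * (\<integral>\<omega>. real (pulls K \<omega> T a) \<partial>P)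
      + 1088000 * (sqrt (v * real T * ln (real K) / real K) + ln (real T))"
proof -
  define \<Delta> where "\<Delta> = \<mu> 1 - \<mu> a"
  define \<Delta>0 where "\<Delta>0 = sqrt (v * real K * ln (real K) / real T)"
  let ?N = "\<integral>\<omega>. real (pulls K \<omega> T a) \<partial>P"
  let ?X = "sqrt (v * real T * ln (real K) / real K)"
  have v0: "0 \<le> v" unfolding v_def using arm_mean_unit[OF one_arm] by simp
  have K: "2 \<le> real K" using K2 by simp
  have lnK: "0 < ln (real K)" using half_le_ln[OF K] by simp
  have lnT: "1 / 2 \<le> ln (real T)" using T by (intro half_le_ln) simp
  have T0: "0 < real T" using T by simp
  have N0: "0 \<le> ?N" by (rule Bochner_Integration.integral_nonneg) simp
  have X0: "0 \<le> ?X" using v0 lnK by simp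
  show ?thesis
  proof (cases "\<Delta> \<le> \<Delta>0")
    case True
    then have "\<Delta> * ?N \<le> \<Delta>0 * ?N" using N0 by (rule mult_right_mono)
    moreover have "0 \<le> 1088000 * (?X + ln (real T))" using X0 lnT by simp
    ultimately show ?thesis unfolding \<Delta>_def \<Delta>0_def by linarith
  next
    case False
    have \<Delta>0: "0 \<le> \<Delta>0" unfolding \<Delta>0_def using v0 lnK by simp
    have \<Delta>: "0 < \<Delta>" "\<Delta>0 < \<Delta>" using False \<Delta>0 by auto
    have \<Delta>1: "\<Delta> \<le> 1" using arm_mean_unit[OF a] arm_mean_unit[OF one_arm] by (simp add: \<Delta>_def)
    define \<kappa> where "\<kappa> = \<Delta>\<^sup>2 / (32 * (v + \<Delta>))"
    have \<kappa>0: "0 < \<kappa>" using v0 \<Delta> by (simp add: \<kappa>_def)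
    have "?N \<le> 3400 * max 1 (ln (real T * \<kappa>)) / \<kappa>"
      using \<Delta> by (intro expectation_pulls[OF a]) (auto simp: \<kappa>_def \<Delta>_def v_def)
    then have "\<Delta> * ?N \<le> \<Delta> * (3400 * max 1 (ln (real T * \<kappa>)) / \<kappa>)"
      using \<Delta> by (intro mult_left_mono) auto
    also have "\<dots> = 3400 * (\<Delta> / \<kappa>) * max 1 (ln (real T * \<kappa>))" by simp
    \<comment> \<open>The variance part \<open>v / \<Delta>\<close> leads to the square-root term,
      the constant part to \<open>ln T\<close>.\<close>
    also have "\<Delta> / \<kappa> = 32 * (v / \<Delta> + 1)"
      using \<Delta> v0 by (simp add: \<kappa>_def power2_eq_square field_simps)
    finally have main: "\<Delta> * ?N \<le> 3400 * (32 * (v / \<Delta> + 1)) * max 1 (ln (real T * \<kappa>))" .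
    have "\<Delta> * ?N \<le> 1088000 * (?X + ln (real T))"
    \<comment> \<open>For \<open>v \<le> \<Delta>\<close> the coefficient is at most 3400 * 64 =
      217600 and the logarithm at most \<open>2 * ln T\<close>. Otherwise
      \<open>v / \<Delta> + 1 \<le> 2 * (v / \<Delta>)\<close>.\<close>
    proof (cases "v \<le> \<Delta>")
      case True
      have "\<Delta>\<^sup>2 \<le> 1 * (32 * (v + \<Delta>))"
        unfolding power2_eq_square using \<Delta> \<Delta>1 v0 by (intro mult_mono) auto
      then have "\<kappa> \<le> 1" unfolding \<kappa>_def using \<Delta> v0 by (simp add: divide_le_eq)
      then have "real T * \<kappa> \<le> real T" using T0 by simp
      then have "ln (real T * \<kappa>) \<le> ln (real T)" using T0 \<kappa>0 by (intro ln_mono) auto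
      then have "max 1 (ln (real T * \<kappa>)) \<le> 2 * ln (real T)" using lnT by simp
      moreover have "3400 * (32 * (v / \<Delta> + 1)) \<le> 217600" using True \<Delta> by (simp add: divide_le_eq)
      ultimately have "3400 * (32 * (v / \<Delta> + 1)) * max 1 (ln (real T * \<kappa>)) \<le> 217600 * (2 * ln (real T))"
        by (intro mult_mono) auto
      also have "\<dots> \<le> 1088000 * (?X + ln (real T))" using X0 lnT by simp
      finally show ?thesis using main by linarith
    next
      case False
      then have v: "0 < v" "\<Delta> < v" using \<Delta> by auto
      \<comment> \<open>\<open>z\<close> bounds \<open>T * \<kappa>\<close> from above, and
        \<open>\<Delta> > \<Delta>0\<close> becomes the hypothesis \<open>K * ln K \<le> z\<close>
        of \<open>max_1_ln_le_sqrt\<close>.\<close>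
      define z where "z = real T * \<Delta>\<^sup>2 / v"
      have z0: "0 < z" using T0 \<Delta> v by (simp add: z_def)
      have "\<Delta>0\<^sup>2 \<le> \<Delta>\<^sup>2" using \<Delta> \<Delta>0 by (intro power_mono) auto
      then have "v * real K * ln (real K) / real T \<le> \<Delta>\<^sup>2"
        unfolding \<Delta>0_def using v0 lnK by simp
      then have z: "real K * ln (real K) \<le> z"
        using T0 v by (simp add: z_def pos_divide_le_eq pos_le_divide_eq mult_ac)
      have "real T * \<kappa> \<le> z"
      proof -
        have "\<Delta>\<^sup>2 / (32 * (v + \<Delta>)) \<le> \<Delta>\<^sup>2 / v" using v \<Delta> by (intro divide_left_mono) auto
        then have "real T * \<kappa> \<le> real T * (\<Delta>\<^sup>2 / v)" unfolding \<kappa>_def using T0 by (intro mult_left_mono) auto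
        then show ?thesis by (simp add: z_def)
      qed
      then have "ln (real T * \<kappa>) \<le> ln z" using T0 \<kappa>0 by (intro ln_mono) auto
      then have "max 1 (ln (real T * \<kappa>)) \<le> max 1 (ln z)" by simp
      also have "\<dots> \<le> 5 * sqrt (z * ln (real K) / real K)" by (rule max_1_ln_le_sqrt[OF K z])
      finally have lnz: "max 1 (ln (real T * \<kappa>)) \<le> 5 * sqrt (z * ln (real K) / real K)" .
      have "3400 * (32 * (v / \<Delta> + 1)) \<le> 217600 * (v / \<Delta>)"
        using v \<Delta> by (simp add: field_simps)
      then have "3400 * (32 * (v / \<Delta> + 1)) * max 1 (ln (real T * \<kappa>))
          \<le> 217600 * (v / \<Delta>) * (5 * sqrt (z * ln (real K) / real K))"
      proof (rule mult_mono[OF _ lnz])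
        show "0 \<le> 217600 * (v / \<Delta>)" using v \<Delta> by simp
      qed simp_all
      also have "\<dots> = 1088000 * ((v / \<Delta>) * sqrt (z * ln (real K) / real K))" by simp
      \<comment> \<open>\<open>\<Delta>\<close> cancels, since \<open>z\<close> is proportional to
        its square; this makes the bound uniform in the gap.\<close>
      also have "(v / \<Delta>) * sqrt (z * ln (real K) / real K) = ?X"
      proof -
        have "(v / \<Delta>) * sqrt (z * ln (real K) / real K) = sqrt ((v / \<Delta>)\<^sup>2 * (z * ln (real K) / real K))"
          using v \<Delta> by (simp only: real_sqrt_mult real_sqrt_abs abs_of_pos divide_pos_pos)
        also have "(v / \<Delta>)\<^sup>2 * (z * ln (real K) / real K) = v * real T * ln (real K) / real K"
          using v \<Delta> by (simp add: z_def power2_eq_square field_simps)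
        finally show ?thesis .
      qed
      also have "1088000 * ?X \<le> 1088000 * (?X + ln (real T))" using lnT by simp
      finally show ?thesis using main by linarith
    qed
    moreover have "0 \<le> \<Delta>0 * ?N" using \<Delta>0 N0 by simp
    ultimately show ?thesis unfolding \<Delta>_def \<Delta>0_def by linarith
  qed
qed

lemma klms_regret_le:
  assumes T: "1 \<le> T"
  shows "klms_regret K nu T \<le> 1088001 *
    (sqrt (\<mu> 1 * (1 - \<mu> 1) * real K * real T * ln (real K)) + real K * ln (real T))"
proof (cases "T = 1")
  case True
  \<comment> \<open>In a single round only arm 1 is pulled, and its gap is 0.\<close>
  have "(\<mu> 1 - \<mu> a) * (\<integral>\<omega>. real (pulls K \<omega> T a) \<partial>P) = 0" for a
    using K2 by (cases "a = 1") (simp_all add: True pulls_forced)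
  then have "klms_regret K nu T = 0" by (simp only: klms_regret_eq sum.neutral_const)
  moreover have "0 \<le> sqrt (\<mu> 1 * (1 - \<mu> 1) * real K * real T * ln (real K))"
    using arm_mean_unit[OF one_arm] K2 by simp
  ultimately show ?thesis by (simp add: True)
next
  case False
  define v where "v = \<mu> 1 * (1 - \<mu> 1)"
  define S where "S = sqrt (v * real K * real T * ln (real K))"
  let ?N = "\<lambda>a. \<integral>\<omega>. real (pulls K \<omega> T a) \<partial>P"
  let ?D = "sqrt (v * real K * ln (real K) / real T)"
  let ?X = "sqrt (v * real T * ln (real K) / real K)"
  have T0: "2 \<le> T" "0 < real T" using T False by auto
  have K0: "0 < real K" "1 \<le> K" using K2 by auto
  have N_int: "integrable P (\<lambda>\<omega>. real (pulls K \<omega> T a))" for a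
    using pulls_le[of K _ T a] by (intro integrable_bounded[where B="real T"]) auto
  have "(\<Sum>a=1..K. ?N a) = (\<integral>\<omega>. (\<Sum>a=1..K. real (pulls K \<omega> T a)) \<partial>P)"
    by (rule Bochner_Integration.integral_sum[symmetric, OF N_int])
  also have "\<dots> = (\<integral>\<omega>. real T \<partial>P)" using sum_pulls[OF K0(2)] by simp
  also have "\<dots> = real T" using prob_space by simp
  finally have N: "(\<Sum>a=1..K. ?N a) = real T" .
  \<comment> \<open>Since the expected counts sum to \<open>T\<close>, the threshold terms add up to
    \<open>T * ?D = S\<close>. The remaining square roots add up to \<open>K * ?X = S\<close>, hence
    the constant 1 + 1088000.\<close>
  have "klms_regret K nu T \<le> (\<Sum>a=1..K. ?D * ?N a + 1088000 * (?X + ln (real T)))"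
    unfolding klms_regret_eq v_def by (rule sum_mono[OF arm_regret_le[OF _ T0(1)]])
  also have "\<dots> = ?D * (\<Sum>a=1..K. ?N a) + real K * (1088000 * (?X + ln (real T)))"
    by (simp add: sum.distrib sum_distrib_left)
  also have "\<dots> = real T * ?D + 1088000 * (real K * ?X + real K * ln (real T))"
    unfolding N by (simp add: algebra_simps)
  also have "real T * ?D = S"
  proof -
    have "real T * ?D = sqrt ((real T)\<^sup>2 * (v * real K * ln (real K) / real T))"
      using T0 by (simp only: real_sqrt_mult real_sqrt_abs abs_of_pos)
    also have "(real T)\<^sup>2 * (v * real K * ln (real K) / real T) = v * real K * real T * ln (real K)"
      using T0 by (simp add: power2_eq_square)
    finally show ?thesis by (simp only: S_def)
  qed
  also have "real K * ?X = S"
  proof -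
    have "real K * ?X = sqrt ((real K)\<^sup>2 * (v * real T * ln (real K) / real K))"
      using K0 by (simp only: real_sqrt_mult real_sqrt_abs abs_of_pos)
    also have "(real K)\<^sup>2 * (v * real T * ln (real K) / real K) = v * real K * real T * ln (real K)"
      using K0 by (simp add: power2_eq_square)
    finally show ?thesis by (simp only: S_def)
  qed
  also have "S + 1088000 * (S + real K * ln (real T)) \<le> 1088001 * (S + real K * ln (real T))"
    using T0 K0 by simp
  finally show ?thesis by (simp only: S_def v_def)
qed

end

theorem theorem3:
  shows "\<exists>C>0. \<forall>(K::nat) (nu::nat \<Rightarrow> real measure) (T::nat).
    2 \<le> K \<and> 1 \<le> T
    \<and> (\<forall>a\<in>{1..K}. prob_space (nu a) \<and> sets (nu a) = sets borel \<and> measure (nu a) {0..1} = 1)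
    \<and> (\<forall>a\<in>{1..K}. \<forall>b\<in>{1..K}. a \<le> b \<longrightarrow> arm_mean nu b \<le> arm_mean nu a)
    \<longrightarrow> klms_regret K nu T \<le> C * (sqrt (arm_mean nu 1 * (1 - arm_mean nu 1) * real K * real T * ln (real K))
                                  + real K * ln (real T))"
proof (intro exI[of _ 1088001] conjI allI impI)
  fix K T :: nat and nu :: "nat \<Rightarrow> real measure"
  assume *: "2 \<le> K \<and> 1 \<le> T
    \<and> (\<forall>a\<in>{1..K}. prob_space (nu a) \<and> sets (nu a) = sets borel \<and> measure (nu a) {0..1} = 1)
    \<and> (\<forall>a\<in>{1..K}. \<forall>b\<in>{1..K}. a \<le> b \<longrightarrow> arm_mean nu b \<le> arm_mean nu a)"
  interpret klms_bandit K nu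
    by (rule klms_bandit.intro) (use * in blast)+
  show "klms_regret K nu T \<le> 1088001 * (sqrt (arm_mean nu 1 * (1 - arm_mean nu 1) * real K * real T * ln (real K))
                                  + real K * ln (real T))"
    using * by (intro klms_regret_le) blast
qed simp

end
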